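(* Let $d\in\mathbb{N}$ and $-d/2<\sigma<1$, $\sigma\ne0$. Then the Riesz kernel $\kappa_\sigma(x)$ is finite for every $x\in\mathbb{Z}^d$ and satisfies, as $|x|\to\infty$, \[ \kappa_\sigma(x)=C_{d,\sigma}|x|^{-d-2\sigma}+O\!\left(|x|^{-d-2\sigma-2}\right),\qquad C_{d,\sigma}=\frac{4^\sigma\Gamma(d/2+\sigma)}{\pi^{d/2}|\Gamma(-\sigma)|}. \] The constant in the Landau symbol can be chosen uniformly over the range of $\sigma$.
   Context: For $f:\mathbb{Z}^d\to\mathbb{R}$ let $\Delta f(x)=\sum_{y:|y-x|=1}(f(x)-f(y))$ ($|\cdot|$ Euclidean norm), with heat semigroup $e^{-t\Delta}$ on $\ell^2(\mathbb{Z}^d)$; $1_0$ is the indicator of $\{0\}$. The Riesz kernel is defined by $\kappa_\sigma(0)=0$ for $\sigma\in(0,1)$, and otherwise (i.e. for $\sigma<0$, and for $\sigma\in(0,1)$ at $x\ne0$) by $\kappa_\sigma(x)=\frac{1}{|\Gamma(-\sigma)|}\int_0^\infty e^{-t\Delta}1_0(x)\,\frac{dt}{t^{1+\sigma}}$. *)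

theory Defs
  imports "HOL-Analysis.Analysis"
begin

definition znorm :: "int ^ 'd \<Rightarrow> real" where
  "znorm x = sqrt (\<Sum>i\<in>UNIV. (real_of_int (x $ i))\<^sup>2)"

definition zlap :: "(int ^ 'd \<Rightarrow> real) \<Rightarrow> (int ^ 'd \<Rightarrow> real)" where
  "zlap f x = (\<Sum>y\<in>{y. znorm (y - x) = 1}. f x - f y)"

definition ind0 :: "int ^ 'd \<Rightarrow> real" where
  "ind0 x = (if x = 0 then 1 else 0)"

text \<open>Heat kernel (e^{-t Delta} 1_0)(x): Delta is bounded on l^2, so e^{-t Delta} is the
  norm-convergent exponential series, evaluated pointwise.\<close>
definition heat_kernel :: "real \<Rightarrow> int ^ 'd \<Rightarrow> real" where
  "heat_kernel t x = (\<Sum>n. (- t) ^ n / fact n * (zlap ^^ n) ind0 x)"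

definition riesz :: "real \<Rightarrow> int ^ 'd \<Rightarrow> real" where
  "riesz \<sigma> x = (if 0 < \<sigma> \<and> \<sigma> < 1 \<and> x = 0 then 0
     else (1 / \<bar>Gamma (- \<sigma>)\<bar>) *
       (LINT t:{0<..}|lborel. heat_kernel t x * t powr (- 1 - \<sigma>)))"

end

(*
The heat kernel factorises into one-dimensional kernels. Each of them is a Fourier integral over a period
whose contour may be moved to the line of height h; no contour integration is needed for this, because for
every choice of heights the product solves the lattice heat equation with the right initial value, and
solutions of exponential growth are unique. With h of order 1 / sqrt t, comparing 2 - 2 cos z with z^2 gives
the local limit theorem p_t(x) = g_t(x) + O(t^(- d/2 - 1) exp (- |x| / sqrt t)) for t >= 1, g being the
Gaussian; with h of order - ln t it gives p_t(x) = O(t^|x| exp (- |x|)) for t <= 1. Integrated against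
t^(- 1 - s), g produces the main term exactly (a Gamma integral), and the difference produces the error.
*)

theory Submission
  imports Defs "HOL-Probability.Probability"
begin

section \<open>The lattice heat equation\<close>

text \<open>The error term is smaller than the Gaussian by one factor 1/t, and the Riesz integral
  lives at t of order |x|^2; this is the gain |x|^-2 in the theorem. Below that scale the decay exp
  (- |x| / sqrt t), weaker than Gaussian, is enough, since it beats every power of t / |x|^2. The
  delicate range is t <= 1, where the continuum approximation fails and t^(- 1 - s) is singular.
  Kernels vanishing only linearly at t = 0 would give a bound that blows up as s tends to 1; taking
  |x| >= 2 secures the order t^2. Uniformity in s then rests on three facts. The main term is exact,
  so the growth of Gamma (d / 2 + s) near s = - d / 2 never enters the error. The integrals of the
  error bound have denominators above 1. And 1 / Gamma is entire, so the normalising factor stays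
  bounded.\<close>

lemma znorm_eq_1_iff:
  fixes z :: "int ^ 'd"
  shows "znorm z = 1 \<longleftrightarrow> (\<exists>i. z = axis i 1 \<or> z = - axis i 1)"
proof
  assume "znorm z = 1"
  then have "(\<Sum>i\<in>UNIV. (real_of_int (z $ i))\<^sup>2) = 1"
    by (simp add: znorm_def)
  then have "real_of_int (\<Sum>i\<in>UNIV. (z $ i)\<^sup>2) = 1"
    by simp
  then have s: "(\<Sum>i\<in>UNIV. (z $ i)\<^sup>2) = 1"
    by linarith
  then obtain i where i: "z $ i \<noteq> 0"
    by (metis (mono_tags, lifting) power_zero_numeral sum.neutral zero_neq_one)
  then have "(z $ i)\<^sup>2 > 0"
    by simp
  then have ge: "(z $ i)\<^sup>2 \<ge> 1"
    by linarith
  have split: "(z $ i)\<^sup>2 + (\<Sum>j\<in>UNIV - {i}. (z $ j)\<^sup>2) = 1"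
    using s by (simp add: sum.remove[of UNIV i])
  have nn: "(\<Sum>j\<in>UNIV - {i}. (z $ j)\<^sup>2) \<ge> 0"
    by (intro sum_nonneg) auto
  have one: "(z $ i)\<^sup>2 = 1" and "(\<Sum>j\<in>UNIV - {i}. (z $ j)\<^sup>2) = 0"
    using split ge nn by linarith+
  then have "\<And>j. j \<noteq> i \<Longrightarrow> z $ j = 0"
    by (subst (asm) sum_nonneg_eq_0_iff) auto
  moreover have "z $ i = 1 \<or> z $ i = - 1"
    using one by (simp add: power2_eq_1_iff)
  ultimately have "z = axis i 1 \<or> z = - axis i 1"
    by (auto simp: vec_eq_iff axis_def)
  then show "\<exists>i. z = axis i 1 \<or> z = - axis i 1" ..
next
  assume "\<exists>i. z = axis i 1 \<or> z = - axis i 1"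
  then obtain i where "z = axis i 1 \<or> z = - axis i 1" ..
  then have "(\<Sum>j\<in>UNIV. (real_of_int (z $ j))\<^sup>2) = (\<Sum>j\<in>UNIV. if j = i then 1 else 0)"
    by (intro sum.cong) (auto simp: axis_def)
  then show "znorm z = 1"
    by (simp add: znorm_def)
qed

lemma zlap_eq:
  fixes f :: "int ^ 'd \<Rightarrow> real"
  shows "zlap f x = (\<Sum>i\<in>UNIV. 2 * f x - f (x + axis i 1) - f (x - axis i 1))"
proof -
  let ?A = "(\<lambda>i. x + axis i 1) ` (UNIV :: 'd set)" and ?B = "(\<lambda>i. x - axis i 1) ` (UNIV :: 'd set)"
  have "{y. znorm (y - x) = 1} = ?A \<union> ?B"
  proof -
    have "y - x = axis i 1 \<longleftrightarrow> y = x + axis i 1" "y - x = - axis i 1 \<longleftrightarrow> y = x - axis i 1" for y i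
      by (auto simp: algebra_simps)
    then show ?thesis
      unfolding znorm_eq_1_iff by blast
  qed
  moreover have "?A \<inter> ?B = {}"
  proof -
    have False if "x + axis i 1 = x - axis j (1::int)" for i j
    proof -
      have "(axis i 1 + axis j 1 :: int ^ 'd) $ i = 0"
        using that by (simp add: algebra_simps)
      then show False
        by (simp add: axis_def split: if_splits)
    qed
    then show ?thesis by blast
  qed
  moreover have "inj (\<lambda>i. x + axis i (1::int))" "inj (\<lambda>i. x - axis i (1::int))"
    by (auto simp: inj_on_def axis_eq_axis)
  ultimately show ?thesis
    by (simp add: zlap_def sum.union_disjoint sum.reindex flip: sum.distrib)
       (simp add: algebra_simps)
qed

section \<open>Iterates of the Laplacian and uniqueness for the heat equation\<close>

lemma zlap_uminus: "zlap (\<lambda>x. - f x) = (\<lambda>x. - zlap f x)"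
  by (auto simp: zlap_def fun_eq_iff simp flip: sum_negf)

lemma zlap_iterate_uminus: "(zlap ^^ n) (\<lambda>x. - f x) = (\<lambda>x. - (zlap ^^ n) f x)"
  by (induction n) (auto simp: zlap_uminus)

lemma has_field_derivative_zlap:
  assumes "\<And>x. ((\<lambda>s. f s x) has_field_derivative f' x) F"
  shows "((\<lambda>s. zlap (f s) x) has_field_derivative zlap f' x) F"
  unfolding zlap_def by (auto intro!: derivative_eq_intros assms)

lemma has_field_derivative_zlap_iterate:
  assumes "\<And>x. ((\<lambda>s. f s x) has_field_derivative f' x) F"
  shows "((\<lambda>s. (zlap ^^ n) (f s) x) has_field_derivative (zlap ^^ n) f' x) F"
  by (induction n arbitrary: x) (auto intro: assms has_field_derivative_zlap)

text \<open>A weight that changes by a factor of at most \<open>L\<close> between neighbours makes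
  the Laplacian bounded in the weighted sup norm, with norm at most d (2 + 2 L). The weight is
  needed because Fourier integrals at nonzero height are bounded only by an exponential in
  space.\<close>

lemma zlap_iterate_bound:
  fixes f w :: "int ^ 'd \<Rightarrow> real"
  assumes w: "\<And>x i. w (x + axis i 1) \<le> L * w x" "\<And>x i. w (x - axis i 1) \<le> L * w x"
    and f: "\<And>x. \<bar>f x\<bar> \<le> K * w x" and K: "K \<ge> 0" and L: "L \<ge> 0"
  shows "\<bar>(zlap ^^ n) f x\<bar> \<le> K * (real CARD('d) * (2 + 2 * L)) ^ n * w x"
proof (induction n arbitrary: x)
  case 0
  then show ?case using f by simp
next
  case (Suc n)
  let ?g = "(zlap ^^ n) f" and ?B = "K * (real CARD('d) * (2 + 2 * L)) ^ n"
  have B: "?B \<ge> 0"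
    using K L by simp
  have "\<bar>2 * ?g x - ?g (x + axis i 1) - ?g (x - axis i 1)\<bar> \<le> ?B * (2 + 2 * L) * w x" for i
  proof -
    have "\<bar>2 * ?g x - ?g (x + axis i 1) - ?g (x - axis i 1)\<bar>
        \<le> 2 * \<bar>?g x\<bar> + \<bar>?g (x + axis i 1)\<bar> + \<bar>?g (x - axis i 1)\<bar>"
      by linarith
    also have "\<dots> \<le> 2 * (?B * w x) + ?B * (L * w x) + ?B * (L * w x)"
      using Suc.IH[of x] order_trans[OF Suc.IH mult_left_mono[OF w(1) B]]
        order_trans[OF Suc.IH mult_left_mono[OF w(2) B]]
      by (intro add_mono mult_left_mono) auto
    finally show ?thesis
      by (simp add: algebra_simps)
  qed
  then have "\<bar>zlap ?g x\<bar> \<le> (\<Sum>i\<in>(UNIV::'d set). ?B * (2 + 2 * L) * w x)"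
    unfolding zlap_eq by (intro order_trans[OF sum_abs] sum_mono) auto
  then show ?case
    by (simp add: algebra_simps)
qed

text \<open>A solution of the lattice heat equation with exponentially bounded growth is entire in time,
  and its Taylor coefficients at 0 are those defining the heat kernel.\<close>

lemma heat_kernel_unique:
  fixes v :: "real \<Rightarrow> int ^ 'd \<Rightarrow> real"
  assumes v0: "v 0 = ind0"
    and ode: "\<And>s x. ((\<lambda>s. v s x) has_field_derivative - zlap (v s) x) (at s)"
    and w: "\<And>x i. w (x + axis i 1) \<le> L * w x" "\<And>x i. w (x - axis i 1) \<le> L * w x"
    and bd: "\<And>s x. \<bar>s\<bar> \<le> \<bar>t\<bar> \<Longrightarrow> \<bar>v s x\<bar> \<le> K * w x" and K: "K \<ge> 0" and L: "L \<ge> 0"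
  shows "heat_kernel t x = v t x"
proof -
  \<comment> \<open>Each time derivative brings down one factor \<open>- zlap\<close>, so this is
    the n-th derivative of \<open>v\<close> at the point \<open>x\<close>.\<close>
  define diff where "diff n s = (- 1) ^ n * (zlap ^^ n) (v s) x" for n :: nat and s :: real
  let ?B = "real CARD('d) * (2 + 2 * L)"
  have d: "(diff m has_field_derivative diff (Suc m) s) (at s)" for m s
  proof -
    have "((\<lambda>s. (- 1) ^ m * (zlap ^^ m) (v s) x) has_field_derivative
            (- 1) ^ m * (zlap ^^ m) (\<lambda>x. - zlap (v s) x) x) (at s)"
      by (intro DERIV_cmult has_field_derivative_zlap_iterate ode)
    then show ?thesis
      unfolding diff_def by (simp add: zlap_iterate_uminus funpow_swap1)
  qed
  \<comment> \<open>Lagrange remainder: the iterates grow geometrically in the weighted norm, so the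
    factorial wins. The intermediate time is only known to satisfy |s| <= |t|, hence the growth
    bound for both signs of time.\<close>
  have rem: "\<bar>v t x - (\<Sum>m<n. (- t) ^ m / fact m * (zlap ^^ m) ind0 x)\<bar> \<le> K * w x * ((?B * \<bar>t\<bar>) ^ n / fact n)" for n
  proof -
    obtain s where s: "\<bar>s\<bar> \<le> \<bar>t\<bar>" "v t x = (\<Sum>m<n. diff m 0 / fact m * t ^ m) + diff n s / fact n * t ^ n"
      using Maclaurin_all_le_objl[of diff "\<lambda>t. v t x" t n] d by (auto simp: diff_def)
    have "(\<Sum>m<n. diff m 0 / fact m * t ^ m) = (\<Sum>m<n. (- t) ^ m / fact m * (zlap ^^ m) ind0 x)"
      by (intro sum.cong) (auto simp: diff_def v0 power_minus[of t])
    then have "\<bar>v t x - (\<Sum>m<n. (- t) ^ m / fact m * (zlap ^^ m) ind0 x)\<bar> = \<bar>diff n s\<bar> * \<bar>t\<bar> ^ n / fact n"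
      using s(2) by (simp add: abs_mult power_abs)
    also have "\<bar>diff n s\<bar> = \<bar>(zlap ^^ n) (v s) x\<bar>"
      by (simp add: diff_def abs_mult)
    also have "\<dots> \<le> K * ?B ^ n * w x"
      using zlap_iterate_bound[of w L "v s" K n x] w bd[OF s(1)] K L by simp
    finally show ?thesis
      by (simp add: power_mult_distrib divide_right_mono mult_right_mono mult_ac)
  qed
  have "(\<lambda>n. K * w x * ((?B * \<bar>t\<bar>) ^ n / fact n)) \<longlonglongrightarrow> 0"
    using tendsto_mult_right_zero[OF summable_LIMSEQ_zero[OF summable_exp[of "?B * \<bar>t\<bar>"]], of "K * w x"]
    by (simp add: field_simps)
  then have "(\<lambda>n. v t x - (\<Sum>m<n. (- t) ^ m / fact m * (zlap ^^ m) ind0 x)) \<longlonglongrightarrow> 0"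
    by (rule Lim_null_comparison[rotated]) (use rem in auto)
  then have "(\<lambda>n. \<Sum>m<n. (- t) ^ m / fact m * (zlap ^^ m) ind0 x) \<longlonglongrightarrow> v t x"
    using tendsto_diff[OF tendsto_const[of "v t x"]] by fastforce
  then show ?thesis
    unfolding heat_kernel_def using sums_unique[of _ "v t x"] by (simp add: sums_def)
qed

section \<open>One-dimensional heat kernels as Fourier integrals\<close>

text \<open>The Fourier integrand of the one-dimensional heat kernel, on the line at height \<open>h\<close>.\<close>

definition fourier_heat :: "real \<Rightarrow> real \<Rightarrow> int \<Rightarrow> real \<Rightarrow> complex" where
  "fourier_heat h s k u = exp (\<i> * of_int k * (of_real u + \<i> * of_real h)
     - of_real s * (2 - 2 * cos (of_real u + \<i> * of_real h)))"

text \<open>Replacing u by -u conjugates the integrand, so the integral is already real and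
  \<open>Re\<close> loses nothing. At height 0 this is exp (- 2 s) I_k (2 s) with the modified
  Bessel function I_k.\<close>

definition line_heat :: "real \<Rightarrow> real \<Rightarrow> int \<Rightarrow> real" where
  "line_heat h s k = Re (integral {-pi..pi} (fourier_heat h s k)) / (2 * pi)"

lemma continuous_on_fourier_heat [continuous_intros]:
  "continuous_on A f \<Longrightarrow> continuous_on A g \<Longrightarrow> continuous_on A (\<lambda>x. fourier_heat h (f x) k (g x))"
  unfolding fourier_heat_def
  by (intro continuous_intros continuous_on_compose2[OF continuous_on_cos[OF continuous_on_id, of UNIV]] subset_UNIV)

lemma fourier_heat_integrable: "fourier_heat h s k integrable_on {a..b}"
  by (intro integrable_continuous_interval continuous_intros)

lemma norm_fourier_heat:
  "norm (fourier_heat h s k u) = exp (- (of_int k * h) - s * (2 - 2 * (cos u * cosh h)))"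
  by (simp add: fourier_heat_def Re_cos cosh_def)

text \<open>Plane waves exp (i k z) are eigenfunctions of the second difference in k, with symbol 2
  - 2 cos z, for complex z as well as real; this is what leaves the height free.\<close>

lemma fourier_heat_shift:
  "fourier_heat h s (k + 1) u + fourier_heat h s (k - 1) u
     = 2 * cos (of_real u + \<i> * of_real h) * fourier_heat h s k u"
proof -
  define z where "z = complex_of_real u + \<i> * of_real h"
  have "fourier_heat h s (k + 1) u = exp (\<i> * z) * fourier_heat h s k u"
    "fourier_heat h s (k - 1) u = exp (- (\<i> * z)) * fourier_heat h s k u"
    unfolding fourier_heat_def z_def[symmetric] exp_add[symmetric] by (simp_all add: algebra_simps)
  then show ?thesis
    by (simp add: cos_exp_eq flip: z_def) (simp add: algebra_simps)
qed

text \<open>Differentiation under the integral brings down minus the symbol, which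
  \<open>fourier_heat_shift\<close> converts into the second difference in \<open>k\<close>.\<close>

lemma line_heat_ode:
  "((\<lambda>s. line_heat h s k) has_field_derivative
     - (2 * line_heat h s k - line_heat h s (k + 1) - line_heat h s (k - 1))) (at s)"
proof -
  let ?E = "fourier_heat h" and ?z = "\<lambda>u. complex_of_real u + \<i> * of_real h"
  have "((\<lambda>s. ?E s k u) has_vector_derivative - (2 - 2 * cos (?z u)) * ?E s k u) (at s within UNIV)" for s u
    unfolding fourier_heat_def
    by (rule has_vector_derivative_real_field) (auto intro!: derivative_eq_intros)
  then have "((\<lambda>s. integral (cbox (-pi) pi) (?E s k)) has_vector_derivative
      integral (cbox (-pi) pi) (\<lambda>u. - (2 - 2 * cos (?z u)) * ?E s k u)) (at s within UNIV)"
    by (rule leibniz_rule_vector_derivative)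
       (auto intro!: fourier_heat_integrable continuous_intros simp: case_prod_unfold)
  moreover have "integral {-pi..pi} (\<lambda>u. - (2 - 2 * cos (?z u)) * ?E s k u)
      = - (2 * integral {-pi..pi} (?E s k) - integral {-pi..pi} (?E s (k + 1))
            - integral {-pi..pi} (?E s (k - 1)))"
  proof -
    have "(\<lambda>u. - (2 - 2 * cos (?z u)) * ?E s k u) = (\<lambda>u. - (2 * ?E s k u - ?E s (k + 1) u - ?E s (k - 1) u))"
      using fourier_heat_shift[of h s k] by (simp add: fun_eq_iff algebra_simps)
    then show ?thesis
      by (simp add: integral_diff integrable_diff integrable_on_mult_right fourier_heat_integrable)
  qed
  ultimately have "((\<lambda>s. integral {-pi..pi} (?E s k)) has_vector_derivative
      - (2 * integral {-pi..pi} (?E s k) - integral {-pi..pi} (?E s (k + 1))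
            - integral {-pi..pi} (?E s (k - 1)))) (at s)"
    by simp
  from bounded_linear.has_vector_derivative[OF bounded_linear_Re this]
  have "((\<lambda>s. Re (integral {-pi..pi} (?E s k))) has_field_derivative
      - (2 * Re (integral {-pi..pi} (?E s k)) - Re (integral {-pi..pi} (?E s (k + 1)))
            - Re (integral {-pi..pi} (?E s (k - 1))))) (at s)"
    by (simp add: has_real_derivative_iff_has_vector_derivative)
  from DERIV_cdivide[OF this, of "2 * pi"] show ?thesis
    unfolding line_heat_def by (simp add: diff_divide_distrib add_divide_distrib)
qed

text \<open>For nonzero k the antiderivative exp (i k z) / (i k) has the same value at both ends of
  the period, at any height, because k is an integer.\<close>

lemma line_heat_0: "line_heat h 0 k = (if k = 0 then 1 else 0)"
proof (cases "k = 0")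
  case True
  then have "fourier_heat h 0 k = (\<lambda>_. 1)"
    by (simp add: fourier_heat_def fun_eq_iff)
  with True show ?thesis
    by (simp add: line_heat_def)
next
  case False
  let ?F = "\<lambda>u. exp (\<i> * of_int k * (of_real u + \<i> * of_real h)) / (\<i> * of_int k)"
  have "(fourier_heat h 0 k has_integral ?F pi - ?F (- pi)) {-pi..pi}"
    unfolding fourier_heat_def
    using False by (intro fundamental_theorem_of_calculus has_vector_derivative_real_field)
      (auto intro!: derivative_eq_intros)
  moreover have "?F pi = ?F (- pi)"
  proof -
    have "exp (\<i> * of_int k * (of_real pi + \<i> * of_real h))
        = exp (\<i> * of_int k * (of_real (- pi) + \<i> * of_real h))"
      unfolding exp_eq by (intro exI[of _ k]) (simp add: algebra_simps)
    then show ?thesis by simp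
  qed
  ultimately show ?thesis
    using False by (simp add: line_heat_def integral_unique)
qed

text \<open>A crude bound with two uses: for fixed h it is the exponential growth bound required for
  uniqueness, and with h of order - ln t it is already sharp enough for short times.\<close>

lemma line_heat_bound:
  "\<bar>line_heat h s k\<bar> \<le> exp (- (of_int k * h) + 2 * \<bar>s\<bar> * (1 + cosh h))"
proof -
  let ?M = "exp (- (of_int k * h) + 2 * \<bar>s\<bar> * (1 + cosh h))"
  have "norm (fourier_heat h s k u) \<le> ?M" for u
  proof -
    have "\<bar>cos u * cosh h\<bar> \<le> 1 * cosh h"
      unfolding abs_mult by (intro mult_mono) auto
    then have "\<bar>s\<bar> * \<bar>2 - 2 * (cos u * cosh h)\<bar> \<le> \<bar>s\<bar> * (2 * (1 + cosh h))"
      using abs_triangle_ineq4[of 2 "2 * (cos u * cosh h)"] by (intro mult_left_mono) auto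
    then have "- s * (2 - 2 * (cos u * cosh h)) \<le> 2 * \<bar>s\<bar> * (1 + cosh h)"
      by (simp add: abs_mult[symmetric] mult_ac)
    then show ?thesis
      by (simp add: norm_fourier_heat)
  qed
  then have "norm (integral {-pi..pi} (fourier_heat h s k)) \<le> integral {-pi..pi} (\<lambda>_. ?M)"
    by (intro integral_norm_bound_integral fourier_heat_integrable) auto
  then have "norm (integral {-pi..pi} (fourier_heat h s k)) \<le> ?M * (2 * pi)"
    by (simp add: mult_ac)
  then have "\<bar>Re (integral {-pi..pi} (fourier_heat h s k))\<bar> \<le> ?M * (2 * pi)"
    using abs_Re_le_cmod order_trans by blast
  then show ?thesis
    by (simp add: line_heat_def abs_mult pos_divide_le_eq)
qed

text \<open>The heights are arbitrary and the left side does not see them. They may therefore differ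
  between coordinates and be chosen after \<open>t\<close> and \<open>x\<close>, in particular with
  the sign of each coordinate of \<open>x\<close>.\<close>

lemma heat_kernel_eq_prod:
  fixes x :: "int ^ 'd" and h :: "'d \<Rightarrow> real"
  shows "heat_kernel t x = (\<Prod>i\<in>UNIV. line_heat (h i) t (x $ i))"
proof (rule heat_kernel_unique[where L = "\<Prod>i\<in>UNIV. exp \<bar>h i\<bar>" and K = "\<Prod>i\<in>UNIV. exp (2 * \<bar>t\<bar> * (1 + cosh (h i)))"
      and v = "\<lambda>s x. \<Prod>i\<in>UNIV. line_heat (h i) s (x $ i)" and w = "\<lambda>x. \<Prod>i\<in>UNIV. exp (- (of_int (x $ i) * h i))"])
  show "(\<lambda>x. \<Prod>i\<in>UNIV. line_heat (h i) 0 (x $ i)) = (ind0 :: int ^ 'd \<Rightarrow> real)"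
  proof
    fix x :: "int ^ 'd"
    show "(\<Prod>i\<in>UNIV. line_heat (h i) 0 (x $ i)) = ind0 x"
      by (auto simp: ind0_def line_heat_0 vec_eq_iff)
  qed
next
  fix s and x :: "int ^ 'd"
  let ?q = "\<lambda>i. line_heat (h i) s"
  have e: "(\<Prod>j\<in>UNIV. ?q j ((x + axis i c) $ j)) = ?q i (x $ i + c) * (\<Prod>j\<in>UNIV - {i}. ?q j (x $ j))" for i c
    by (subst prod.remove[of _ i]) (auto simp: axis_def intro!: prod.cong)
  have "zlap (\<lambda>x. \<Prod>j\<in>UNIV. ?q j (x $ j)) x
      = (\<Sum>i\<in>UNIV. (2 * ?q i (x $ i) - ?q i (x $ i + 1) - ?q i (x $ i - 1)) * (\<Prod>j\<in>UNIV - {i}. ?q j (x $ j)))"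
    unfolding zlap_eq
  proof (intro sum.cong refl)
    fix i
    have "x - axis i 1 = x + axis i (- 1)"
      by (simp add: vec_eq_iff axis_def)
    then show "2 * (\<Prod>j\<in>UNIV. ?q j (x $ j)) - (\<Prod>j\<in>UNIV. ?q j ((x + axis i 1) $ j)) - (\<Prod>j\<in>UNIV. ?q j ((x - axis i 1) $ j))
      = (2 * ?q i (x $ i) - ?q i (x $ i + 1) - ?q i (x $ i - 1)) * (\<Prod>j\<in>UNIV - {i}. ?q j (x $ j))"
      unfolding \<open>x - axis i 1 = x + axis i (- 1)\<close> e
      by (simp add: prod.remove[of UNIV i] algebra_simps)
  qed
  then have "- zlap (\<lambda>x. \<Prod>j\<in>UNIV. ?q j (x $ j)) x
      = (\<Sum>i\<in>UNIV. - (2 * ?q i (x $ i) - ?q i (x $ i + 1) - ?q i (x $ i - 1)) * (\<Prod>j\<in>UNIV - {i}. ?q j (x $ j)))"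
    by (simp only: sum_negf mult_minus_left)
  then show "((\<lambda>s. \<Prod>i\<in>UNIV. line_heat (h i) s (x $ i)) has_field_derivative
          - zlap (\<lambda>x. \<Prod>i\<in>UNIV. line_heat (h i) s (x $ i)) x) (at s)"
    using has_field_derivative_prod[where f = "\<lambda>i s. line_heat (h i) s (x $ i)" and A = UNIV, OF line_heat_ode, of s]
    by (simp only:)
next
  fix x :: "int ^ 'd" and i :: 'd
  \<comment> \<open>A displacement by at most 1 in coordinate j changes the exponent there by at
    most |h j|. The general form covers both directions of a lattice step.\<close>
  have *: "(\<Prod>j\<in>UNIV. exp (- (of_int ((x + y) $ j) * h j))) \<le> (\<Prod>j\<in>UNIV. exp \<bar>h j\<bar>) * (\<Prod>j\<in>UNIV. exp (- (of_int (x $ j) * h j)))"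
    if "\<And>j. \<bar>y $ j\<bar> \<le> 1" for y :: "int ^ 'd"
    unfolding prod.distrib[symmetric]
  proof (intro prod_mono conjI)
    fix j
    have "\<bar>of_int (y $ j) * h j\<bar> \<le> 1 * \<bar>h j\<bar>"
      unfolding abs_mult using that[of j] by (intro mult_right_mono) auto
    then show "exp (- (of_int ((x + y) $ j) * h j)) \<le> exp \<bar>h j\<bar> * exp (- (of_int (x $ j) * h j))"
      by (simp add: exp_add[symmetric] algebra_simps)
  qed simp
  show "(\<Prod>j\<in>UNIV. exp (- (of_int ((x + axis i 1) $ j) * h j))) \<le> (\<Prod>j\<in>UNIV. exp \<bar>h j\<bar>) * (\<Prod>j\<in>UNIV. exp (- (of_int (x $ j) * h j)))"
    by (intro *) (auto simp: axis_def)
  show "(\<Prod>j\<in>UNIV. exp (- (of_int ((x - axis i 1) $ j) * h j))) \<le> (\<Prod>j\<in>UNIV. exp \<bar>h j\<bar>) * (\<Prod>j\<in>UNIV. exp (- (of_int (x $ j) * h j)))"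
    using *[of "- axis i 1"] by (auto simp: axis_def)
next
  fix s :: real and x :: "int ^ 'd"
  assume s: "\<bar>s\<bar> \<le> \<bar>t\<bar>"
  show "\<bar>\<Prod>i\<in>UNIV. line_heat (h i) s (x $ i)\<bar>
    \<le> (\<Prod>i\<in>UNIV. exp (2 * \<bar>t\<bar> * (1 + cosh (h i)))) * (\<Prod>i\<in>UNIV. exp (- (of_int (x $ i) * h i)))"
    unfolding abs_prod prod.distrib[symmetric]
  proof (intro prod_mono conjI)
    fix i
    have "2 * \<bar>s\<bar> * (1 + cosh (h i)) \<le> 2 * \<bar>t\<bar> * (1 + cosh (h i))"
      using s cosh_real_nonneg[of "h i"] by (intro mult_right_mono) auto
    then show "\<bar>line_heat (h i) s (x $ i)\<bar> \<le> exp (2 * \<bar>t\<bar> * (1 + cosh (h i))) * exp (- (of_int (x $ i) * h i))"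
      using line_heat_bound[of "h i" s "x $ i"]
      by (intro order_trans[OF line_heat_bound]) (simp add: exp_add[symmetric])
  qed simp
qed (auto intro: prod_nonneg)

section \<open>The one-dimensional local limit theorem\<close>

definition line_gauss :: "real \<Rightarrow> real \<Rightarrow> real" where
  "line_gauss t y = exp (- y\<^sup>2 / (4 * t)) / sqrt (4 * pi * t)"

text \<open>The integrand of \<open>fourier_heat\<close> with the symbol 2 - 2 cos z replaced by its
  leading term z^2, on the same line Im z = h, so that the two can be compared point by
  point.\<close>

definition fourier_gauss :: "real \<Rightarrow> real \<Rightarrow> real \<Rightarrow> real \<Rightarrow> complex" where
  "fourier_gauss h t y u = exp (\<i> * of_real y * (of_real u + \<i> * of_real h) - of_real t * (of_real u + \<i> * of_real h)\<^sup>2)"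

section \<open>Fourier integrals of Gaussians, from the characteristic function of the normal
  law\<close>

lemma has_bochner_integral_fourier_std_normal:
  "has_bochner_integral lborel (\<lambda>x. exp (\<i> * of_real (b * x) - (of_real x)\<^sup>2 / 2)) (complex_of_real (sqrt (2 * pi) * exp (- b\<^sup>2 / 2)))"
proof -
  have eq: "exp (\<i> * of_real (b * x) - (of_real x)\<^sup>2 / 2) = sqrt (2 * pi) *\<^sub>R (std_normal_density x *\<^sub>R iexp (b * x))" for x
  proof -
    have "std_normal_density x *\<^sub>R iexp (b * x) = of_real (1 / sqrt (2 * pi)) * exp (of_real (- x\<^sup>2 / 2)) * iexp (b * x)"
      by (simp add: std_normal_density_def scaleR_conv_of_real flip: exp_of_real)
    also have "\<dots> = of_real (1 / sqrt (2 * pi)) * exp (\<i> * of_real (b * x) - (of_real x)\<^sup>2 / 2)"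
      unfolding mult.assoc exp_add[symmetric] by (simp add: algebra_simps)
    finally show ?thesis
      by (simp add: scaleR_conv_of_real)
  qed
  have 1: "integrable std_normal_distribution (\<lambda>x. iexp (b * x))"
    by (rule prob_space.integrable_iexp[OF prob_space_normal_density]) auto
  then have "integrable lborel (\<lambda>x. std_normal_density x *\<^sub>R iexp (b * x))"
    by (subst (asm) integrable_density) auto
  moreover have "(LINT x|lborel. std_normal_density x *\<^sub>R iexp (b * x)) = complex_of_real (exp (- b\<^sup>2 / 2))"
    using fun_cong[OF char_std_normal_distribution, of b]
    unfolding char_def by (subst (asm) integral_density) auto
  ultimately show ?thesis
    unfolding has_bochner_integral_iff eq by (simp add: scaleR_conv_of_real)
qed

text \<open>Expanding the square shows that height h only changes the frequency from y to y - 2 t h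
  and adds the real constant t h^2 - y h. Rescaling by \<open>c = sqrt (2 * t)\<close> reduces this
  to the standard normal, and completing the square in the result makes h cancel.\<close>

lemma has_bochner_integral_fourier_gauss:
  assumes t: "t > 0"
  shows "has_bochner_integral lborel (fourier_gauss h t y) (complex_of_real (2 * pi * line_gauss t y))"
proof -
  define c where "c = sqrt (2 * t)"
  define b where "b = (y - 2 * t * h) / c"
  have c: "c > 0" "c\<^sup>2 = 2 * t"
    using t by (auto simp: c_def)
  have f: "fourier_gauss h t y u = exp (of_real (t * h\<^sup>2 - y * h)) * exp (\<i> * of_real (b * (0 + c * u)) - (of_real (0 + c * u))\<^sup>2 / 2)" for u
  proof -
    have "complex_of_real (b * (0 + c * u)) = of_real ((y - 2 * t * h) * u)"
      using c by (simp add: b_def)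
    moreover have "(complex_of_real (0 + c * u))\<^sup>2 = of_real (2 * t * u\<^sup>2)"
      by (metis add_0 c(2) of_real_power power_mult_distrib)
    ultimately have "\<i> * of_real y * (of_real u + \<i> * of_real h) - of_real t * (of_real u + \<i> * of_real h)\<^sup>2
        = of_real (t * h\<^sup>2 - y * h) + (\<i> * of_real (b * (0 + c * u)) - (of_real (0 + c * u))\<^sup>2 / 2)"
      by (simp only:) (simp add: complex_eq_iff power2_eq_square algebra_simps)
    then show ?thesis
      unfolding fourier_gauss_def exp_add[symmetric] by (rule arg_cong)
  qed
  have "has_bochner_integral lborel (\<lambda>u. exp (\<i> * of_real (b * (0 + c * u)) - (of_real (0 + c * u))\<^sup>2 / 2))
      (complex_of_real (sqrt (2 * pi) * exp (- b\<^sup>2 / 2)) /\<^sub>R \<bar>c\<bar>)"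
    using c has_bochner_integral_fourier_std_normal[of b]
    by (subst (asm) lborel_has_bochner_integral_real_affine_iff[where c = c and t = 0]) auto
  then have "has_bochner_integral lborel (fourier_gauss h t y)
      (exp (of_real (t * h\<^sup>2 - y * h)) * (complex_of_real (sqrt (2 * pi) * exp (- b\<^sup>2 / 2)) /\<^sub>R \<bar>c\<bar>))"
    unfolding f[abs_def] by (rule has_bochner_integral_mult_right)
  moreover have "exp (of_real (t * h\<^sup>2 - y * h)) * (complex_of_real (sqrt (2 * pi) * exp (- b\<^sup>2 / 2)) /\<^sub>R \<bar>c\<bar>)
      = of_real (2 * pi * line_gauss t y)"
  proof -
    have "b\<^sup>2 / 2 = (y - 2 * t * h)\<^sup>2 / (4 * t)"
      using c by (simp add: b_def power_divide)
    then have e: "t * h\<^sup>2 - y * h + (- b\<^sup>2 / 2) = - y\<^sup>2 / (4 * t)"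
      using t by (simp add: field_simps power2_eq_square)
    have s: "sqrt (2 * pi) / c = 2 * pi / sqrt (4 * pi * t)"
    proof -
      have "sqrt (2 * pi) / c = (sqrt (2 * pi) * sqrt (2 * pi)) / (sqrt (2 * pi) * c)"
        by (rule mult_divide_mult_cancel_left[symmetric]) auto
      moreover have "sqrt (4 * pi * t) = sqrt (2 * pi) * c"
        by (simp add: c_def flip: real_sqrt_mult)
      ultimately show ?thesis by simp
    qed
    have "exp (t * h\<^sup>2 - y * h) * (sqrt (2 * pi) * exp (- b\<^sup>2 / 2) / c)
        = exp (t * h\<^sup>2 - y * h + (- b\<^sup>2 / 2)) * (sqrt (2 * pi) / c)"
      unfolding exp_add by simp
    also have "\<dots> = 2 * pi * line_gauss t y"
      unfolding e s line_gauss_def by simp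
    finally have "complex_of_real (exp (t * h\<^sup>2 - y * h) * (sqrt (2 * pi) * exp (- b\<^sup>2 / 2) / c)) = of_real (2 * pi * line_gauss t y)"
      by (rule arg_cong)
    then show ?thesis
      unfolding exp_of_real using c by (simp add: scaleR_conv_of_real field_simps)
  qed
  ultimately show ?thesis by simp
qed

section \<open>Pointwise comparison of the two Fourier integrands\<close>

lemma norm_fourier_gauss: "norm (fourier_gauss h t y u) = exp (- (y * h) - t * (u\<^sup>2 - h\<^sup>2))"
  by (simp add: fourier_gauss_def power2_eq_square)

text \<open>Mean value inequality on the half-plane Re z <= M, which is convex and on which the
  derivative of exp is bounded by exp M.\<close>

lemma norm_exp_diff_le:
  fixes a b :: complex
  assumes "Re a \<le> M" "Re b \<le> M"
  shows "norm (exp a - exp b) \<le> exp M * norm (a - b)"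
proof (rule field_differentiable_bound[where S = "{z. Re z \<le> M}" and f' = exp])
  show "convex {z. Re z \<le> M}"
    using convex_halfspace_Re_le[of M] by simp
qed (auto intro!: derivative_eq_intros assms)

text \<open>Fourth-order Taylor remainder of cos. The remainder carries exp |Im z| / 6, at most 3 /
  6 in this strip, and doubling gives the constant 1.\<close>

lemma norm_two_minus_two_cos:
  fixes z :: complex
  assumes "\<bar>Im z\<bar> \<le> 1"
  shows "norm (2 - 2 * cos z - z\<^sup>2) \<le> norm z ^ 4"
proof -
  have "(\<Sum>k\<le>3. complex_of_real (cos_coeff k) * z ^ k) = 1 - z\<^sup>2 / 2"
    by (simp add: numeral_eq_Suc cos_coeff_def) presburger
  then have "norm (cos z - (1 - z\<^sup>2 / 2)) \<le> exp \<bar>Im z\<bar> * norm z ^ 4 / 6"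
    using Taylor_cos[of z 3] by (simp add: fact_numeral)
  moreover have "exp \<bar>Im z\<bar> \<le> 3"
    using assms exp_le order_trans by (metis exp_le_cancel_iff)
  then have "exp \<bar>Im z\<bar> * norm z ^ 4 / 6 \<le> norm z ^ 4 / 2"
    using mult_right_mono[of "exp \<bar>Im z\<bar>" 3 "norm z ^ 4"] by simp
  ultimately have "norm (cos z - (1 - z\<^sup>2 / 2)) \<le> norm z ^ 4 / 2"
    by (rule order_trans)
  moreover have "2 - 2 * cos z - z\<^sup>2 = - 2 * (cos z - (1 - z\<^sup>2 / 2))"
    by (simp add: algebra_simps)
  then have "norm (2 - 2 * cos z - z\<^sup>2) = 2 * norm (cos z - (1 - z\<^sup>2 / 2))"
    by (simp only: norm_mult norm_neg_numeral)
  ultimately show ?thesis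
    by linarith
qed

text \<open>The preceding estimate at the imaginary point i h, where cos becomes cosh, with h^4 <=
  h^2.\<close>

lemma cosh_le_quadratic:
  fixes h :: real
  assumes "\<bar>h\<bar> \<le> 1"
  shows "cosh h \<le> 1 + h\<^sup>2"
proof -
  have "norm (2 - 2 * cos (\<i> * of_real h) - (\<i> * complex_of_real h)\<^sup>2) \<le> norm (\<i> * complex_of_real h) ^ 4"
    using assms by (intro norm_two_minus_two_cos) simp
  moreover have "cos (\<i> * complex_of_real h) = of_real (cosh h)"
    by (simp add: complex_eq_iff Re_cos Im_cos cosh_def)
  moreover have "2 - 2 * of_real (cosh h) - (\<i> * complex_of_real h)\<^sup>2 = complex_of_real (2 - 2 * cosh h + h\<^sup>2)"
    by (simp add: power_mult_distrib)
  ultimately have "\<bar>2 - 2 * cosh h + h\<^sup>2\<bar> \<le> \<bar>h\<bar> ^ 4"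
    by (metis norm_mult norm_ii norm_of_real mult_1)
  moreover have "\<bar>h\<bar> ^ 4 \<le> \<bar>h\<bar> ^ 2"
    using assms by (intro power_decreasing) auto
  ultimately show ?thesis
    by simp
qed

text \<open>Gives Gaussian decay over the whole period. The 9 comes from |sin y| >= |y| / 3 for y =
  u / 2: there |y| <= 2, so the cubic Taylor remainder |y|^3 / 6 is at most 2 |y| / 3.\<close>

lemma two_minus_two_cos_ge:
  fixes u :: real
  assumes "\<bar>u\<bar> \<le> pi"
  shows "u\<^sup>2 / 9 \<le> 2 - 2 * cos u"
proof -
  define y where "y = u / 2"
  have y: "\<bar>y\<bar> \<le> 2"
    using assms pi_less_4 by (simp add: y_def)
  have "\<bar>sin y - (\<Sum>m<3. sin_coeff m * y ^ m)\<bar> \<le> inverse (fact 3) * \<bar>y\<bar> ^ 3"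
    by (rule Maclaurin_sin_bound)
  then have "\<bar>sin y - y\<bar> \<le> \<bar>y\<bar> ^ 3 / 6"
    by (simp add: numeral_eq_Suc sin_coeff_def)
  moreover have "\<bar>y\<bar> ^ 3 \<le> 4 * \<bar>y\<bar>"
    using mult_right_mono[OF mult_mono[OF y y], of "\<bar>y\<bar>"] by (simp add: power3_eq_cube)
  ultimately have "\<bar>y\<bar> / 3 \<le> \<bar>sin y\<bar>"
    by linarith
  then have "(\<bar>y\<bar> / 3)\<^sup>2 \<le> \<bar>sin y\<bar>\<^sup>2"
    by (intro power_mono) auto
  then have "y\<^sup>2 / 9 \<le> (sin y)\<^sup>2"
    by (simp add: power_divide)
  moreover have "2 - 2 * cos u = 4 * (sin y)\<^sup>2"
    using cos_double_sin[of y] by (simp add: y_def)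
  ultimately show ?thesis
    by (simp add: y_def power_divide)
qed

text \<open>The height \<open>h\<close> with \<open>t * h\<^sup>2 = 1\<close> costs only a bounded factor in the integrand and turns the
  oscillation into the exponential decay \<open>exp (- \<bar>k\<bar> / sqrt t)\<close>.\<close>

lemma norm_fourier_heat_diff:
  assumes t: "t \<ge> 1" and h: "t * h\<^sup>2 = 1" and u: "\<bar>u\<bar> \<le> pi"
  shows "norm (fourier_heat h t k u - fourier_gauss h t (of_int k) u)
      \<le> exp (- (of_int k * h)) * (2 * exp 2 * ((t * u ^ 4 + 1 / t) * exp (- (t * u\<^sup>2) / 9)))"
proof -
  define z where "z = complex_of_real u + \<i> * of_real h"
  \<comment> \<open>A common upper bound for the real parts of both exponents. The 2 is the price t
    * 2 h^2 of the height, and the 1/9 is that of \<open>two_minus_two_cos_ge\<close>.\<close>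
  define M where "M = - (of_int k * h) + 2 - t * u\<^sup>2 / 9"
  have h2: "h\<^sup>2 = 1 / t"
    using h t by (simp add: field_simps)
  then have "h\<^sup>2 \<le> 1"
    using t by simp
  then have h1: "\<bar>h\<bar> \<le> 1"
    by (simp add: abs_square_le_1)
  have "norm (fourier_heat h t k u - fourier_gauss h t (of_int k) u)
      \<le> exp M * norm ((\<i> * of_int k * z - of_real t * (2 - 2 * cos z)) - (\<i> * of_real (of_int k) * z - of_real t * z\<^sup>2))"
    unfolding fourier_heat_def fourier_gauss_def z_def[symmetric]
  proof (rule norm_exp_diff_le)
    \<comment> \<open>Splits the right side as cosh h (2 - 2 cos u) - 2 (cosh h - 1): the first part
      is at least u^2 / 9, the second subtracts at most 2 h^2.\<close>
    have "u\<^sup>2 / 9 - 2 * h\<^sup>2 \<le> 2 - 2 * (cos u * cosh h)"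
    proof -
      have "1 * (2 - 2 * cos u) \<le> cosh h * (2 - 2 * cos u)"
        by (intro mult_right_mono cosh_real_ge_1) auto
      then show ?thesis
        using two_minus_two_cos_ge[OF u] cosh_le_quadratic[OF h1] by (simp add: algebra_simps)
    qed
    then have "t * (u\<^sup>2 / 9 - 2 * h\<^sup>2) \<le> t * (2 - 2 * (cos u * cosh h))"
      using t by (intro mult_left_mono) auto
    moreover have "Re (cos z) = cos u * cosh h"
      by (simp add: z_def Re_cos cosh_def)
    ultimately show "Re (\<i> * of_int k * z - of_real t * (2 - 2 * cos z)) \<le> M"
      using h by (simp add: z_def M_def algebra_simps)
    have "t * u\<^sup>2 / 9 \<le> t * u\<^sup>2"
      using t by simp
    then show "Re (\<i> * of_real (of_int k) * z - of_real t * z\<^sup>2) \<le> M"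
      using h by (simp add: z_def M_def power2_eq_square algebra_simps)
  qed
  also have "(\<i> * of_int k * z - of_real t * (2 - 2 * cos z)) - (\<i> * of_real (of_int k) * z - of_real t * z\<^sup>2)
      = - of_real t * (2 - 2 * cos z - z\<^sup>2)"
    by (simp add: algebra_simps)
  also have "norm \<dots> \<le> t * norm z ^ 4"
    using t h1 norm_two_minus_two_cos[of z] by (simp add: norm_mult z_def)
  also have "norm z ^ 4 = (u\<^sup>2 + h\<^sup>2)\<^sup>2"
  proof -
    have "norm z ^ 4 = ((norm z)\<^sup>2)\<^sup>2" by simp
    then show ?thesis by (simp only: cmod_power2) (simp add: z_def)
  qed
  also have "t * (u\<^sup>2 + h\<^sup>2)\<^sup>2 \<le> 2 * (t * u ^ 4 + 1 / t)"
  proof -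
    have "(u\<^sup>2 + h\<^sup>2)\<^sup>2 \<le> 2 * (u ^ 4 + (h\<^sup>2)\<^sup>2)"
      using sum_squares_bound[of "u\<^sup>2" "h\<^sup>2"] by (simp add: power2_sum)
    then have "t * (u\<^sup>2 + h\<^sup>2)\<^sup>2 \<le> t * (2 * (u ^ 4 + (h\<^sup>2)\<^sup>2))"
      using t by (intro mult_left_mono) auto
    also have "\<dots> = 2 * (t * u ^ 4 + t * (h\<^sup>2)\<^sup>2)"
      by algebra
    also have "t * (h\<^sup>2)\<^sup>2 = 1 / t"
      unfolding h2 using t by (simp add: power2_eq_square)
    finally show ?thesis .
  qed
  also have "exp M * (2 * (t * u ^ 4 + 1 / t)) = exp (- (of_int k * h)) * (2 * exp 2 * ((t * u ^ 4 + 1 / t) * exp (- (t * u\<^sup>2) / 9)))"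
  proof -
    have "exp M = exp (- (of_int k * h)) * exp 2 * exp (- (t * u\<^sup>2) / 9)"
      by (simp add: M_def flip: exp_add)
    then show ?thesis by simp
  qed
  finally show ?thesis
    by (simp add: mult_left_mono)
qed

lemma integrable_quartic_gauss: "integrable lborel (\<lambda>x::real. (x ^ 4 + 1) * exp (- x\<^sup>2 / 9))"
proof -
  \<comment> \<open>Chosen so that (c x)^2 / 2 = x^2 / 9, which makes the integrand a combination of
    standard normal moments.\<close>
  define c :: real where "c = sqrt 2 / 3"
  have c: "c \<noteq> 0" "c\<^sup>2 = 2 / 9"
    by (auto simp: c_def power_divide)
  have "integrable lborel (\<lambda>x. std_normal_density (0 + c * x) * (0 + c * x) ^ k)" for k
    using c by (intro lborel_integrable_real_affine integrable_std_normal_moment)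
  from Bochner_Integration.integrable_add[OF integrable_mult_right[OF this, of "sqrt (2 * pi) / c ^ 4" 4] integrable_mult_right[OF this, of "sqrt (2 * pi)" 0]]
  show ?thesis
    using c by (simp add: std_normal_density_def power_mult_distrib algebra_simps)
qed

text \<open>Under x = sqrt t * u both terms of the polynomial scale like 1/t and du gives 1 / sqrt
  t. Compared with the size 1 / sqrt t of the Gaussian kernel itself, this is the gain of one power
  of t.\<close>

lemma integral_quartic_gauss_scale:
  assumes "t > 0"
  shows "has_bochner_integral lborel (\<lambda>u. (t * u ^ 4 + 1 / t) * exp (- (t * u\<^sup>2) / 9))
     ((LINT x|lborel. (x ^ 4 + 1) * exp (- x\<^sup>2 / 9)) / (t * sqrt t))"
proof -
  define c where "c = sqrt t"
  have c: "c > 0" "c\<^sup>2 = t" "c ^ 4 = t\<^sup>2"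
    using assms power_mult[of c 2 2] by (auto simp: c_def)
  have "has_bochner_integral lborel (\<lambda>x::real. (x ^ 4 + 1) * exp (- x\<^sup>2 / 9)) (LINT x|lborel. (x ^ 4 + 1) * exp (- x\<^sup>2 / 9))"
    by (intro has_bochner_integral_integrable integrable_quartic_gauss)
  then have "has_bochner_integral lborel (\<lambda>u. ((0 + c * u) ^ 4 + 1) * exp (- (0 + c * u)\<^sup>2 / 9))
     ((LINT x|lborel. (x ^ 4 + 1) * exp (- x\<^sup>2 / 9)) /\<^sub>R \<bar>c\<bar>)"
    using c by (subst (asm) lborel_has_bochner_integral_real_affine_iff[where c = c and t = 0]) auto
  from has_bochner_integral_mult_right[OF this, of "1 / t"]
  show ?thesis
    using c assms by (simp add: power_mult_distrib field_simps power2_eq_square flip: c_def)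
qed

text \<open>The sign of \<open>h\<close> is left open: choosing it as the sign of \<open>k\<close>
  turns the factor into exp (- |k| / sqrt t).\<close>

lemma line_heat_minus_line_gauss:
  obtains C where "C > 0"
    "\<And>t h k. t \<ge> 1 \<Longrightarrow> t * h\<^sup>2 = 1 \<Longrightarrow>
       \<bar>line_heat h t k - line_gauss t (of_int k)\<bar> \<le> C * exp (- (of_int k * h)) / (t * sqrt t)"
proof
  let ?K = "LINT x|lborel. (x ^ 4 + 1) * exp (- x\<^sup>2 / 9 :: real)"
  have K: "?K \<ge> 0"
    by (intro integral_nonneg_AE) auto
  \<comment> \<open>The first summand is 2 e^2 K over the 2 pi of the Fourier inversion; the 1
    ensures positivity from K >= 0 alone.\<close>
  show "exp 2 * ?K / pi + 1 > 0"
    using K by (intro add_nonneg_pos) auto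
  fix t h :: real and k :: int
  assume t: "t \<ge> 1" and h: "t * h\<^sup>2 = 1"
  let ?F = "fourier_heat h t k" and ?G = "fourier_gauss h t (of_int k)"
  \<comment> \<open>The heat integrand is cut off at the period, the Gaussian one is not. Outside
    the period only the Gaussian tail is left, and the same majorant covers it because t u^4 >= 1
    there.\<close>
  let ?D = "\<lambda>u. indicator {-pi..pi} u *\<^sub>R ?F u - ?G u"
  let ?B = "\<lambda>u. (exp (- (of_int k * h)) * (2 * exp 2)) * ((t * u ^ 4 + 1 / t) * exp (- (t * u\<^sup>2) / 9))"
  have F: "set_integrable lborel {-pi..pi} ?F"
    by (intro borel_integrable_atLeastAtMost' continuous_intros)
  have G: "has_bochner_integral lborel ?G (2 * pi * line_gauss t (of_int k))"
    using t has_bochner_integral_fourier_gauss[of t h "of_int k"] by simp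
  have B: "has_bochner_integral lborel ?B ((exp (- (of_int k * h)) * (2 * exp 2)) * (?K / (t * sqrt t)))"
    using t by (intro has_bochner_integral_mult_right integral_quartic_gauss_scale) auto
  have le: "norm (?D u) \<le> ?B u" for u
  proof (cases "\<bar>u\<bar> \<le> pi")
    case True
    then have "u \<in> {-pi..pi}" by auto
    then show ?thesis
      using norm_fourier_heat_diff[OF t h True, of k] by (simp add: mult_ac)
  next
    case False
    then have u1: "1 \<le> \<bar>u\<bar>"
      using pi_ge_two by linarith
    then have "1 \<le> \<bar>u\<bar> ^ 4"
      by (intro one_le_power)
    then have "1 * 1 \<le> t * u ^ 4"
      using t by (intro mult_mono) auto
    moreover have "1 / t \<ge> 0"
      using t by simp
    ultimately have ge1: "1 \<le> t * u ^ 4 + 1 / t"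
      by linarith
    have "t * (u\<^sup>2 - h\<^sup>2) = t * u\<^sup>2 - 1"
      using h by (simp add: algebra_simps)
    moreover have "t * u\<^sup>2 / 9 \<le> t * u\<^sup>2"
      using t by simp
    ultimately have "norm (?G u) \<le> exp (- (of_int k * h) + 2 + - (t * u\<^sup>2) / 9)"
      by (simp add: norm_fourier_gauss)
    also have "\<dots> = exp (- (of_int k * h)) * exp 2 * (1 * exp (- (t * u\<^sup>2) / 9))"
      by (simp only: exp_add)
    also have "\<dots> \<le> exp (- (of_int k * h)) * (2 * exp 2) * ((t * u ^ 4 + 1 / t) * exp (- (t * u\<^sup>2) / 9))"
      using ge1 by (intro mult_mono mult_right_mono) auto
    finally have "norm (?G u) \<le> ?B u" .
    moreover have "u \<notin> {-pi..pi}"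
      using False by auto
    ultimately show ?thesis by simp
  qed
  have I: "integrable lborel ?D"
    using F G unfolding set_integrable_def
    by (auto simp: has_bochner_integral_iff intro!: Bochner_Integration.integrable_diff)
  have "norm (LINT u|lborel. ?D u) \<le> (LINT u|lborel. ?B u)"
    using I integrable.intros[OF B] le by (rule Bochner_Integration.integral_norm_bound_integral)
  moreover have "(LINT u|lborel. ?D u) = integral {-pi..pi} ?F - 2 * pi * line_gauss t (of_int k)"
    using F G set_borel_integral_eq_integral(2)[OF F]
    by (simp add: set_integrable_def set_lebesgue_integral_def has_bochner_integral_iff)
  moreover have "(LINT u|lborel. ?B u) = (exp (- (of_int k * h)) * (2 * exp 2)) * (?K / (t * sqrt t))"
    by (rule has_bochner_integral_integral_eq[OF B])
  ultimately have "norm (integral {-pi..pi} ?F - 2 * pi * line_gauss t (of_int k))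
      \<le> (exp (- (of_int k * h)) * (2 * exp 2)) * (?K / (t * sqrt t))"
    by (simp only:)
  then have "\<bar>Re (integral {-pi..pi} ?F - 2 * pi * line_gauss t (of_int k))\<bar>
      \<le> (exp (- (of_int k * h)) * (2 * exp 2)) * (?K / (t * sqrt t))"
    using abs_Re_le_cmod order_trans by blast
  then have "\<bar>2 * pi * (line_heat h t k - line_gauss t (of_int k))\<bar>
      \<le> 2 * pi * (exp 2 * ?K / pi * exp (- (of_int k * h)) / (t * sqrt t))"
    by (simp add: line_heat_def algebra_simps)
  then have "2 * pi * \<bar>line_heat h t k - line_gauss t (of_int k)\<bar>
      \<le> 2 * pi * (exp 2 * ?K / pi * exp (- (of_int k * h)) / (t * sqrt t))"
    by (simp only: abs_mult abs_numeral abs_of_pos[OF pi_gt_zero])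
  then have "\<bar>line_heat h t k - line_gauss t (of_int k)\<bar> \<le> exp 2 * ?K / pi * exp (- (of_int k * h)) / (t * sqrt t)"
    by (rule mult_left_le_imp_le) simp
  also have "\<dots> \<le> (exp 2 * ?K / pi + 1) * exp (- (of_int k * h)) / (t * sqrt t)"
    using t by (intro divide_right_mono mult_right_mono) auto
  finally show "\<bar>line_heat h t k - line_gauss t (of_int k)\<bar> \<le> (exp 2 * ?K / pi + 1) * exp (- (of_int k * h)) / (t * sqrt t)" .
qed

section \<open>Comparison with the Gaussian kernel\<close>

text \<open>The 1-norm is what products over coordinates produce: the factors exp (- |x_i| / sqrt t)
  and t^|x_i| collect their exponents in it.\<close>

definition lnorm :: "int ^ 'd \<Rightarrow> real" where
  "lnorm x = (\<Sum>i\<in>UNIV. \<bar>real_of_int (x $ i)\<bar>)"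

definition gauss_kernel :: "real \<Rightarrow> int ^ 'd \<Rightarrow> real" where
  "gauss_kernel t x = exp (- (znorm x)\<^sup>2 / (4 * t)) / (4 * pi * t) powr (real CARD('d) / 2)"

lemma znorm_power2: "(znorm x)\<^sup>2 = (\<Sum>i\<in>UNIV. (real_of_int (x $ i))\<^sup>2)"
  by (simp add: znorm_def sum_nonneg)

lemma znorm_le_lnorm: "znorm x \<le> lnorm x"
  unfolding znorm_def lnorm_def using L2_set_le_sum_abs[of "\<lambda>i. real_of_int (x $ i)" UNIV]
  by (simp add: L2_set_def)

lemma lnorm_ge_1: "x \<noteq> 0 \<Longrightarrow> lnorm x \<ge> 1"
proof -
  assume "x \<noteq> 0"
  then obtain i where "x $ i \<noteq> 0"
    by (auto simp: vec_eq_iff)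
  then have "1 \<le> \<bar>x $ i\<bar>" by linarith
  then have "1 \<le> \<bar>real_of_int (x $ i)\<bar>" by linarith
  also have "\<dots> \<le> lnorm x"
    unfolding lnorm_def by (rule member_le_sum) auto
  finally show ?thesis .
qed

lemma prod_line_gauss:
  fixes x :: "int ^ 'd"
  assumes t: "t > 0"
  shows "(\<Prod>i\<in>UNIV. line_gauss t (of_int (x $ i))) = gauss_kernel t x"
proof -
  have "(\<Prod>i\<in>UNIV. line_gauss t (of_int (x $ i)))
      = exp (\<Sum>i\<in>UNIV. - (of_int (x $ i))\<^sup>2 / (4 * t)) / sqrt (4 * pi * t) ^ CARD('d)"
    by (simp add: line_gauss_def prod_dividef exp_sum)
  also have "sqrt (4 * pi * t) ^ CARD('d) = (4 * pi * t) powr (real CARD('d) / 2)"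
    using t by (simp add: powr_half_sqrt[symmetric] powr_powr flip: powr_realpow)
  also have "(\<Sum>i\<in>UNIV. - (of_int (x $ i))\<^sup>2 / (4 * t)) = - (znorm x)\<^sup>2 / (4 * t)"
    by (simp add: znorm_power2 sum_negf sum_divide_distrib)
  finally show ?thesis
    by (simp add: gauss_kernel_def)
qed

lemma line_gauss_bounds:
  assumes t: "t > 0"
  shows "0 \<le> line_gauss t y" "line_gauss t y \<le> exp 1 * (exp (- \<bar>y\<bar> / sqrt t) / sqrt t)"
proof -
  show "0 \<le> line_gauss t y"
    using t by (simp add: line_gauss_def)
  define w where "w = \<bar>y\<bar> / sqrt t"
  \<comment> \<open>This square gives - w^2 / 4 <= 1 - w, which trades Gaussian decay for
    exponential decay at the cost of a factor e, matching the form of the heat kernel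
    estimate.\<close>
  have "0 \<le> (w / 2 - 1)\<^sup>2"
    by simp
  then have "w \<le> 1 + w\<^sup>2 / 4"
    by (simp add: power2_eq_square algebra_simps)
  moreover have "- y\<^sup>2 / (4 * t) = - (w\<^sup>2 / 4)" "- \<bar>y\<bar> / sqrt t = - w"
    using t by (simp_all add: w_def power_divide)
  ultimately have "- y\<^sup>2 / (4 * t) \<le> 1 + - \<bar>y\<bar> / sqrt t"
    by linarith
  then have "exp (- y\<^sup>2 / (4 * t)) \<le> exp 1 * exp (- \<bar>y\<bar> / sqrt t)"
    by (simp flip: exp_add)
  moreover have "1 * t \<le> 4 * pi * t"
    using t pi_ge_two by (intro mult_right_mono) auto
  then have "sqrt t \<le> sqrt (4 * pi * t)"
    by simp
  ultimately have "line_gauss t y \<le> (exp 1 * exp (- \<bar>y\<bar> / sqrt t)) / sqrt t"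
    unfolding line_gauss_def using t by (intro frac_le) auto
  then show "line_gauss t y \<le> exp 1 * (exp (- \<bar>y\<bar> / sqrt t) / sqrt t)"
    by simp
qed

lemma gauss_kernel_nonneg: "gauss_kernel t x \<ge> 0"
  by (simp add: gauss_kernel_def)

lemma gauss_kernel_le:
  fixes x :: "int ^ 'd"
  assumes t: "t > 0"
  shows "gauss_kernel t x \<le> exp (- (znorm x)\<^sup>2 / (4 * t)) * t powr (- real CARD('d) / 2)"
proof -
  have "1 * t \<le> 4 * pi * t"
    using t pi_ge_two by (intro mult_right_mono) auto
  then have "t powr (real CARD('d) / 2) \<le> (4 * pi * t) powr (real CARD('d) / 2)"
    using t by (intro powr_mono2) auto
  then have "gauss_kernel t x \<le> exp (- (znorm x)\<^sup>2 / (4 * t)) / t powr (real CARD('d) / 2)"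
    unfolding gauss_kernel_def using t by (intro divide_left_mono) auto
  then show ?thesis
    by (simp add: powr_minus_divide)
qed

text \<open>Dividing the i-th factor of each product by a common majorant \<open>b i\<close> brings
  all factors into [-1, 1]. There a difference of products is at most the sum of the differences of
  the factors, so the single factor 1/t of the one-dimensional estimate survives.\<close>

lemma heat_kernel_minus_gauss_large_time:
  obtains C where "C > 0"
    "\<And>t (x :: int ^ 'd). t \<ge> 1 \<Longrightarrow>
       \<bar>heat_kernel t x - gauss_kernel t x\<bar> \<le> C * exp (- lnorm x / sqrt t) * t powr (- real CARD('d) / 2 - 1)"
proof -
  obtain C where C: "C > 0"
    "\<And>t h k. t \<ge> 1 \<Longrightarrow> t * h\<^sup>2 = 1 \<Longrightarrow>
       \<bar>line_heat h t k - line_gauss t (of_int k)\<bar> \<le> C * exp (- (of_int k * h)) / (t * sqrt t)"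
    by (rule line_heat_minus_line_gauss) blast
  \<comment> \<open>C bounds the one-dimensional difference and e the Gaussian, so their sum bounds
    the one-dimensional heat kernel too.\<close>
  define B where "B = C + exp 1"
  have B: "B > 0"
    using C(1) by (simp add: B_def add_pos_pos)
  let ?d = "CARD('d)"
  have "\<bar>heat_kernel t x - gauss_kernel t x\<bar>
      \<le> (B ^ ?d * (real ?d * (C / B))) * exp (- lnorm x / sqrt t) * t powr (- real ?d / 2 - 1)"
    if t: "t \<ge> 1" for t and x :: "int ^ 'd"
  proof -
    define h where "h i = (if x $ i < 0 then - 1 else 1) / sqrt t" for i
    define b where "b i = B * (exp (- \<bar>real_of_int (x $ i)\<bar> / sqrt t) / sqrt t)" for i
    have h: "t * (h i)\<^sup>2 = 1" "- (of_int (x $ i) * h i) = - \<bar>real_of_int (x $ i)\<bar> / sqrt t" for i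
      using t by (auto simp: h_def power_divide)
    have b: "b i > 0" for i
      using t B by (simp add: b_def)
    let ?p = "\<lambda>i. line_heat (h i) t (x $ i)" and ?g = "\<lambda>i. line_gauss t (of_int (x $ i))"
    have diff: "\<bar>?p i - ?g i\<bar> \<le> C / B / t * b i" for i
      using C(2)[OF t h(1), of i "x $ i"] B unfolding h(2) b_def by (simp add: field_simps)
    have g: "\<bar>?g i\<bar> \<le> exp 1 / B * b i" for i
      using line_gauss_bounds[of t "of_int (x $ i)"] t B by (simp add: b_def)
    have "C / B / t \<le> C / B"
      using t B C(1) by (simp add: field_simps)
    then have "C / B / t * b i \<le> C / B * b i" for i
      using b[of i] by (intro mult_right_mono) auto
    then have "\<bar>?p i\<bar> \<le> C / B * b i + exp 1 / B * b i" for i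
      using diff[of i] g[of i] by (smt (verit))
    moreover have "C / B * b i + exp 1 / B * b i = b i" for i
      using B by (simp add: B_def field_simps flip: add_divide_distrib)
    ultimately have p: "\<bar>?p i\<bar> \<le> b i" for i
      by simp
    have "0 \<le> C / B * b i" for i
      using C(1) B b[of i] by simp
    then have g: "\<bar>?g i\<bar> \<le> b i" for i
      using g[of i] \<open>C / B * b i + exp 1 / B * b i = b i\<close> by (smt (verit))
    have "\<bar>(\<Prod>i\<in>UNIV. ?p i) - (\<Prod>i\<in>UNIV. ?g i)\<bar>
        = (\<Prod>i\<in>UNIV. b i) * norm ((\<Prod>i\<in>UNIV. ?p i / b i) - (\<Prod>i\<in>UNIV. ?g i / b i))"
    proof -
      have P: "(\<Prod>i\<in>UNIV. b i) > 0"
        using b by (intro prod_pos) auto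
      have eq: "(\<Prod>i\<in>UNIV. ?p i / b i) - (\<Prod>i\<in>UNIV. ?g i / b i)
          = ((\<Prod>i\<in>UNIV. ?p i) - (\<Prod>i\<in>UNIV. ?g i)) / (\<Prod>i\<in>UNIV. b i)"
        by (simp only: prod_dividef diff_divide_distrib)
      have "\<bar>u\<bar> = c * \<bar>u / c\<bar>" if "c > 0" for u c :: real
        using that by simp
      from this[OF P] show ?thesis
        unfolding eq real_norm_def .
    qed
    also have "\<dots> \<le> (\<Prod>i\<in>UNIV. b i) * (\<Sum>i\<in>UNIV. norm (?p i / b i - ?g i / b i))"
      using p g b by (intro mult_left_mono norm_prod_diff prod_nonneg)
        (auto simp: less_imp_le abs_of_pos)
    also have "\<dots> \<le> (\<Prod>i\<in>UNIV. b i) * (\<Sum>i\<in>(UNIV :: 'd set). C / B / t)"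
    proof (intro mult_left_mono sum_mono prod_nonneg)
      fix i
      have "norm (?p i / b i - ?g i / b i) = \<bar>?p i - ?g i\<bar> / b i"
        using b[of i] by (simp add: abs_of_pos flip: diff_divide_distrib)
      also have "\<dots> \<le> C / B / t"
        using diff[of i] b[of i] by (simp add: pos_divide_le_eq)
      finally show "norm (?p i / b i - ?g i / b i) \<le> C / B / t" .
    qed (use b less_imp_le in auto)
    also have "(\<Prod>i\<in>UNIV. b i) = B ^ ?d * (exp (- lnorm x / sqrt t) / sqrt t ^ ?d)"
      by (simp add: b_def prod.distrib prod_dividef lnorm_def sum_negf sum_divide_distrib flip: exp_sum)
    also have "B ^ ?d * (exp (- lnorm x / sqrt t) / sqrt t ^ ?d) * (\<Sum>i\<in>(UNIV :: 'd set). C / B / t)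
        = (B ^ ?d * (real ?d * (C / B))) * exp (- lnorm x / sqrt t) * (t powr (- real ?d / 2) / t)"
    proof -
      have "sqrt t ^ ?d = t powr (real ?d / 2)"
        using t by (simp add: powr_half_sqrt[symmetric] powr_powr flip: powr_realpow)
      then have p: "t powr (- real ?d / 2) = 1 / sqrt t ^ ?d"
        by (simp add: powr_minus_divide)
      have "a * (e / s) * (n * (c / t)) = a * (n * c) * e * (1 / s / t)" for a e s n c t :: real
        by simp
      then show ?thesis
        unfolding p sum_constant .
    qed
    also have "t powr (- real ?d / 2) / t = t powr (- real ?d / 2 - 1)"
      using t by (simp add: powr_diff)
    finally show ?thesis
      using heat_kernel_eq_prod[of t x h] prod_line_gauss[of t x] t by simp
  qed
  moreover have "B ^ ?d * (real ?d * (C / B)) > 0"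
    using B C(1) by simp
  ultimately show ?thesis
    using that by blast
qed

text \<open>For short times the heights \<open>1 - ln t\<close> are used instead: each unit of height gains a factor \<open>t\<close> per
  lattice step.\<close>

lemma heat_kernel_small_time:
  fixes x :: "int ^ 'd"
  assumes t: "0 < t" "t \<le> 1"
  shows "\<bar>heat_kernel t x\<bar> \<le> exp 8 ^ CARD('d) * (exp (- lnorm x) * t powr lnorm x)"
proof -
  define h where "h i = (if x $ i < 0 then - 1 else 1) * (1 - ln t)" for i
  have lt: "ln t \<le> 0"
    using t by simp
  have "t * cosh (h i) \<le> exp 1" for i
  proof -
    have "cosh (h i) = cosh (1 - ln t)"
      by (cases "x $ i < 0") (simp_all only: h_def if_True if_False mult_1 mult_minus1 cosh_minus)
    also have "\<dots> \<le> exp (1 - ln t)"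
    proof -
      have "exp (- (1 - ln t)) \<le> exp (1 - ln t)"
        using lt by (subst exp_le_cancel_iff) simp
      then show ?thesis
        by (simp add: cosh_def)
    qed
    also have "\<dots> = exp 1 / t"
      using t by (simp add: exp_diff)
    finally show ?thesis
      using t by (simp add: field_simps)
  qed
  \<comment> \<open>With e <= 3 this is 2 t + 2 t cosh (h i) <= 2 + 6.\<close>
  then have c: "2 * \<bar>t\<bar> * (1 + cosh (h i)) \<le> 8" for i
    using t exp_le order_trans[OF _ exp_le, of "t * cosh (h i)"] by (simp add: algebra_simps)
  have l: "\<bar>line_heat (h i) t (x $ i)\<bar> \<le> exp 8 * (exp (- \<bar>real_of_int (x $ i)\<bar>) * t powr \<bar>real_of_int (x $ i)\<bar>)" for i
  proof -
    have "\<bar>line_heat (h i) t (x $ i)\<bar> \<le> exp (- (of_int (x $ i) * h i) + 2 * \<bar>t\<bar> * (1 + cosh (h i)))"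
      by (rule line_heat_bound)
    also have "\<dots> \<le> exp (- (of_int (x $ i) * h i) + 8)"
      using c[of i] by simp
    \<comment> \<open>The summand 1 in the height yields exp (- |x_i|), the summand - ln t yields
      t^|x_i|.\<close>
    also have "- (of_int (x $ i) * h i) + 8 = 8 + (- \<bar>real_of_int (x $ i)\<bar> + \<bar>real_of_int (x $ i)\<bar> * ln t)"
      by (simp add: h_def algebra_simps)
    finally show ?thesis
      using t by (simp add: powr_def flip: exp_add)
  qed
  have "\<bar>heat_kernel t x\<bar> \<le> (\<Prod>i\<in>UNIV. exp 8 * (exp (- \<bar>real_of_int (x $ i)\<bar>) * t powr \<bar>real_of_int (x $ i)\<bar>))"
    unfolding heat_kernel_eq_prod[of t x h] abs_prod by (intro prod_mono) (use l in auto)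
  also have "\<dots> = exp 8 ^ CARD('d) * (exp (- lnorm x) * t powr lnorm x)"
    using t by (simp add: prod.distrib lnorm_def powr_sum sum_negf flip: exp_sum)
  finally show ?thesis .
qed

lemma exp_minus_le_powr:
  fixes y :: real
  assumes "y > 0"
  shows "exp (- y) \<le> fact n * y powr (- real n)"
proof -
  have "y ^ n / fact n \<le> exp y"
  proof -
    have "(\<lambda>k. y ^ k /\<^sub>R fact k) sums exp y"
      by (rule exp_converges)
    then have "(\<Sum>k\<in>{n}. y ^ k /\<^sub>R fact k) \<le> exp y"
      using assms by (intro sum_le_suminf[of "\<lambda>k. y ^ k /\<^sub>R fact k" "{n}", THEN order_trans])
        (auto simp: sums_iff)
    then show ?thesis
      by (simp add: field_simps)
  qed
  then show ?thesis
    using assms by (simp add: exp_minus powr_minus powr_realpow field_simps)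
qed

text \<open>The bounds are split at the parabolic scale t = |x|^2, where both branches equal |x|^(-
  d - 2). Below it, exponential decay is used as the power (|x| / sqrt t)^(- d - 6); against t^(- d
  / 2 - 1) this leaves exactly t^2 |x|^(- d - 6). For t <= 1 the same form holds because the heat
  kernel is of order t^|x| and |x| >= 2.\<close>

lemma heat_kernel_minus_gauss_bound:
  obtains C where "C > 0"
    "\<And>t (x :: int ^ 'd). t > 0 \<Longrightarrow> znorm x \<ge> 2 \<Longrightarrow>
       \<bar>heat_kernel t x - gauss_kernel t x\<bar>
         \<le> C * (if t \<le> (znorm x)\<^sup>2 then t\<^sup>2 * znorm x powr (- real CARD('d) - 6) else t powr (- real CARD('d) / 2 - 1))"
proof -
  let ?d = "real CARD('d)" and ?n = "CARD('d) + 6"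
  obtain C where C: "C > 0"
    "\<And>t (x :: int ^ 'd). t \<ge> 1 \<Longrightarrow>
       \<bar>heat_kernel t x - gauss_kernel t x\<bar> \<le> C * exp (- lnorm x / sqrt t) * t powr (- ?d / 2 - 1)"
    by (rule heat_kernel_minus_gauss_large_time) blast
  define C' where "C' = C * fact ?n + C + exp 8 ^ CARD('d) * fact ?n + fact ?n * 4 ^ ?n"
  have C': "C * fact ?n \<le> C'" "C \<le> C'" "exp 8 ^ CARD('d) * fact ?n + fact ?n * 4 ^ ?n \<le> C'" "C' > 0"
    using C(1) by (auto simp: C'_def add_pos_pos)
  have "\<bar>heat_kernel t x - gauss_kernel t x\<bar>
       \<le> C' * (if t \<le> (znorm x)\<^sup>2 then t\<^sup>2 * znorm x powr (- ?d - 6) else t powr (- ?d / 2 - 1))"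
    if t: "t > 0" and x: "znorm x \<ge> 2" for t and x :: "int ^ 'd"
  proof -
    define r where "r = znorm x"
    have r: "r \<ge> 2" "r \<le> lnorm x"
      using x znorm_le_lnorm[of x] by (auto simp: r_def)
    show ?thesis
    proof (cases "t \<ge> 1")
      case True
      show ?thesis
      proof (cases "t \<le> (znorm x)\<^sup>2")
        case le: True
        have "exp (- lnorm x / sqrt t) \<le> exp (- (r / sqrt t))"
          using r(2) t by (simp add: divide_right_mono)
        also have "\<dots> \<le> fact ?n * (r / sqrt t) powr (- real ?n)"
          using t r by (intro exp_minus_le_powr) auto
        also have "(r / sqrt t) powr (- real ?n) = r powr (- ?d - 6) * t powr (?d / 2 + 3)"
          using t r by (simp add: powr_divide powr_half_sqrt[symmetric] powr_powr powr_minus_divide[of _ "_ / _"] field_simps flip: powr_add)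
        finally have "C * exp (- lnorm x / sqrt t) * t powr (- ?d / 2 - 1)
            \<le> C * (fact ?n * (r powr (- ?d - 6) * t powr (?d / 2 + 3))) * t powr (- ?d / 2 - 1)"
          using C(1) by (intro mult_right_mono mult_left_mono) auto
        also have "\<dots> = C * fact ?n * (r powr (- ?d - 6) * (t powr (?d / 2 + 3) * t powr (- ?d / 2 - 1)))"
          by (simp only: mult_ac)
        also have "t powr (?d / 2 + 3) * t powr (- ?d / 2 - 1) = t\<^sup>2"
          using t by (simp flip: powr_add)
        also have "C * fact ?n * (r powr (- ?d - 6) * t\<^sup>2) \<le> C' * (r powr (- ?d - 6) * t\<^sup>2)"
          using C' by (intro mult_right_mono) auto
        finally show ?thesis
          using C(2)[OF True, of x] le by (simp add: r_def mult_ac)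
      next
        case False
        have "C * exp (- lnorm x / sqrt t) \<le> C' * 1"
          using C' C(1) t r by (intro mult_mono) auto
        then have "C * exp (- lnorm x / sqrt t) * t powr (- ?d / 2 - 1) \<le> C' * t powr (- ?d / 2 - 1)"
          by (intro mult_right_mono) auto
        then show ?thesis
          using C(2)[OF True, of x] False by simp
      qed
    next
      case False
      then have t1: "t \<le> 1" by simp
      have "2\<^sup>2 \<le> r\<^sup>2"
        using r by (intro power_mono) auto
      then have le: "t \<le> r\<^sup>2"
        using t1 by simp
      have p: "exp (- lnorm x) * t powr lnorm x \<le> (fact ?n * r powr (- ?d - 6)) * t\<^sup>2"
      proof (intro mult_mono)
        have "exp (- lnorm x) \<le> exp (- r)"
          using r by simp
        also have "\<dots> \<le> fact ?n * r powr (- real ?n)"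
          using r by (intro exp_minus_le_powr) auto
        finally show "exp (- lnorm x) \<le> fact ?n * r powr (- ?d - 6)"
          by (simp add: algebra_simps)
        have "t powr lnorm x \<le> t powr 2"
          using t t1 r by (intro powr_mono') auto
        then show "t powr lnorm x \<le> t\<^sup>2"
          using t by simp
      qed auto
      \<comment> \<open>For short times the exponential absorbs the singular prefactor t^(- d / 2):
        \<open>?n\<close> powers of t leave t^(d / 2 + 6), which is at most t^2.\<close>
      have g: "gauss_kernel t x \<le> (fact ?n * 4 ^ ?n * r powr (- ?d - 6)) * t\<^sup>2"
      proof -
        have "exp (- (znorm x)\<^sup>2 / (4 * t)) = exp (- (r\<^sup>2 / (4 * t)))"
          by (simp add: r_def)
        also have "\<dots> \<le> fact ?n * (r\<^sup>2 / (4 * t)) powr (- real ?n)"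
          using t r by (intro exp_minus_le_powr) auto
        also have "(r\<^sup>2 / (4 * t)) powr (- real ?n) = 4 ^ ?n * (r powr (- 2 * real ?n)) * t powr real ?n"
        proof -
          define N where "N = real ?n"
          have "(r\<^sup>2) powr N = r powr (2 * N)"
            using r by (simp add: powr_powr flip: powr_numeral)
          moreover have "4 ^ ?n = (4::real) powr N"
            unfolding N_def by (rule powr_realpow[symmetric]) simp
          ultimately show ?thesis
            unfolding N_def[symmetric] using t r by (simp add: powr_minus powr_divide powr_mult field_simps)
        qed
        also have "r powr (- 2 * real ?n) \<le> r powr (- ?d - 6)"
          using r by (intro powr_mono) auto
        finally have "exp (- (znorm x)\<^sup>2 / (4 * t)) \<le> fact ?n * (4 ^ ?n * r powr (- ?d - 6) * t powr real ?n)"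
          using t by (simp add: mult_left_mono mult_right_mono)
        then have "gauss_kernel t x \<le> fact ?n * (4 ^ ?n * r powr (- ?d - 6) * t powr real ?n) * t powr (- ?d / 2)"
          by (intro order_trans[OF gauss_kernel_le[OF t]] mult_right_mono) auto
        also have "\<dots> = (fact ?n * 4 ^ ?n * r powr (- ?d - 6)) * (t powr real ?n * t powr (- ?d / 2))"
          by (simp only: mult_ac)
        also have "t powr real ?n * t powr (- ?d / 2) = t powr (?d / 2 + 6)"
          by (simp add: field_simps flip: powr_add)
        also have "t powr (?d / 2 + 6) \<le> t powr 2"
          using t t1 by (intro powr_mono') auto
        also have "t powr 2 = t\<^sup>2"
          using t by simp
        finally show ?thesis
          by (simp add: mult_left_mono)
      qed
      have "\<bar>heat_kernel t x - gauss_kernel t x\<bar> \<le> \<bar>heat_kernel t x\<bar> + gauss_kernel t x"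
        using gauss_kernel_nonneg[of t x] by linarith
      also have "\<dots> \<le> exp 8 ^ CARD('d) * ((fact ?n * r powr (- ?d - 6)) * t\<^sup>2) + (fact ?n * 4 ^ ?n * r powr (- ?d - 6)) * t\<^sup>2"
        using p g by (intro add_mono order_trans[OF heat_kernel_small_time[OF t t1]] mult_left_mono) auto
      also have "\<dots> = (exp 8 ^ CARD('d) * fact ?n + fact ?n * 4 ^ ?n) * (t\<^sup>2 * r powr (- ?d - 6))"
        by (simp add: algebra_simps)
      also have "\<dots> \<le> C' * (t\<^sup>2 * r powr (- ?d - 6))"
        using C'(3) by (intro mult_right_mono) auto
      finally show ?thesis
        using le by (simp add: r_def)
    qed
  qed
  with C'(4) show ?thesis
    using that by blast
qed

section \<open>The Riesz integrals\<close>

text \<open>Passes from gauge integrals, in which the explicit integrals are computed, to Lebesgue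
  integrals over \<open>lborel\<close>. Nonnegativity gives absolute integrability for the completed
  measure, and Borel measurability removes the completion.\<close>

lemma set_lebesgue_integral_of_has_integral:
  fixes f :: "real \<Rightarrow> real"
  assumes f: "(f has_integral I) S" and S: "S \<in> sets borel" and m: "f \<in> borel_measurable borel"
    and nn: "\<And>x. x \<in> S \<Longrightarrow> 0 \<le> f x"
  shows "set_integrable lborel S f" "(LINT x:S|lborel. f x) = I"
proof -
  have "f absolutely_integrable_on S"
    using f nn by (intro nonnegative_absolutely_integrable_1) auto
  then have "integrable (completion lborel) (\<lambda>x. indicator S x *\<^sub>R f x)"
    by (simp add: set_integrable_def)
  moreover have "(\<lambda>x. indicator S x *\<^sub>R f x) \<in> borel_measurable lborel"
    using S m by simp
  ultimately show "set_integrable lborel S f"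
    unfolding set_integrable_def by (subst (asm) integrable_completion)
  then show "(LINT x:S|lborel. f x) = I"
    using f by (simp add: set_borel_integral_eq_integral(2) integral_unique)
qed

lemma has_integral_greaterThan_iff_atLeast:
  fixes f :: "real \<Rightarrow> real"
  shows "(f has_integral I) {a<..} \<longleftrightarrow> (f has_integral I) {a..}"
proof (rule has_integral_spike_set_eq)
  show "negligible {x \<in> {a<..} - {a..}. f x \<noteq> 0}"
    by (rule negligible_subset[OF negligible_empty]) auto
  show "negligible {x \<in> {a..} - {a<..}. f x \<noteq> 0}"
    by (rule negligible_subset[OF negligible_sing[of a]]) auto
qed

text \<open>Euler's integral for Gamma under the substitution y = a / t.\<close>

lemma has_integral_Gamma_inverse:
  fixes a s :: real
  assumes a: "a > 0" and s: "s > 0"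
  shows "((\<lambda>t. t powr (- 1 - s) * exp (- a / t)) has_integral a powr (- s) * Gamma s) {0<..}"
proof -
  let ?f = "\<lambda>y. y powr (s - 1) / exp y :: real"
  let ?h = "\<lambda>t. \<bar>- a / t\<^sup>2\<bar> * ?f (a / t)"
  have f: "(?f has_integral Gamma s) {0<..}"
    using Gamma_integral_real[OF s] by (simp add: has_integral_greaterThan_iff_atLeast)
  then have "?f absolutely_integrable_on {0<..} \<and> integral {0<..} ?f = Gamma s"
    by (auto intro!: nonnegative_absolutely_integrable_1 simp: integral_unique)
  moreover have "(\<lambda>t. a / t) ` {0<..} = {0<..}"
  proof -
    have "y \<in> (\<lambda>t. a / t) ` {0<..}" if "y > 0" for y
      using a that by (intro image_eqI[of _ _ "a / y"]) auto
    then show ?thesis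
      using a by auto
  qed
  moreover have "inj_on (\<lambda>t. a / t) {0<..}"
    using a by (auto simp: inj_on_def)
  moreover have "((\<lambda>t. a / t) has_field_derivative - a / t\<^sup>2) (at t within {0<..})" if "t \<in> {0<..}" for t
    using that by (auto intro!: derivative_eq_intros simp: power2_eq_square)
  ultimately have "?h absolutely_integrable_on {0<..} \<and> integral {0<..} ?h = Gamma s"
    using has_absolute_integral_change_of_variables_1'[of "{0<..}" "\<lambda>t. a / t" "\<lambda>t. - a / t\<^sup>2" ?f "Gamma s"]
    by simp
  then have "(?h has_integral Gamma s) {0<..}"
    using set_lebesgue_integral_eq_integral(1) by (metis integrable_integral)
  then have "((\<lambda>t. a powr (- s) * ?h t) has_integral a powr (- s) * Gamma s) {0<..}"
    by (rule has_integral_mult_right)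
  then show ?thesis
  proof (rule has_integral_eq[rotated])
    fix t :: real
    assume "t \<in> {0<..}"
    then have t: "t > 0" by simp
    have "a powr (- s) * a * (a powr (s - 1)) = 1"
      using a by (simp add: powr_minus powr_diff)
    moreover have "t powr (- 1 - s) = 1 / (t\<^sup>2 * t powr (s - 1))"
    proof -
      have "t\<^sup>2 * t powr (s - 1) = t powr (2 + (s - 1))"
        using t by (simp only: powr_add powr_numeral)
      then show ?thesis
        by (simp add: powr_minus_divide[symmetric])
    qed
    ultimately show "a powr (- s) * ?h t = t powr (- 1 - s) * exp (- a / t)"
      using a t by (simp add: powr_divide exp_minus field_simps)
  qed
qed

text \<open>The source of the constant in the theorem: \<open>has_integral_Gamma_inverse\<close>
  applies with a = |x|^2 / 4 and s = d / 2 + \<sigma>, and in (4 pi)^(- d / 2) * 4^(d / 2 +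
  \<sigma>) the powers 4^(d / 2) cancel.\<close>

lemma gauss_kernel_riesz_integral:
  fixes x :: "int ^ 'd"
  assumes x: "znorm x > 0" and \<sigma>: "- real CARD('d) / 2 < \<sigma>"
  shows "set_integrable lborel {0<..} (\<lambda>t. gauss_kernel t x * t powr (- 1 - \<sigma>))"
    "(LINT t:{0<..}|lborel. gauss_kernel t x * t powr (- 1 - \<sigma>))
       = 4 powr \<sigma> * Gamma (real CARD('d) / 2 + \<sigma>) / pi powr (real CARD('d) / 2)
           * znorm x powr (- real CARD('d) - 2 * \<sigma>)"
proof -
  define D where "D = real CARD('d) / 2"
  define r where "r = znorm x"
  define a where "a = r\<^sup>2 / 4"
  have r: "r > 0" and a: "a > 0"
    using x by (auto simp: r_def a_def)
  have D: "D + \<sigma> > 0"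
    using \<sigma> by (simp add: D_def)
  have eq: "gauss_kernel t x * t powr (- 1 - \<sigma>) = (4 * pi) powr (- D) * (t powr (- 1 - (D + \<sigma>)) * exp (- a / t))"
    if t: "t > 0" for t
  proof -
    have "gauss_kernel t x = exp (- a / t) * ((4 * pi) powr (- D) * t powr (- D))"
      using t by (simp add: gauss_kernel_def a_def r_def D_def powr_mult powr_minus field_simps)
    moreover have "t powr (- D) * t powr (- 1 - \<sigma>) = t powr (- 1 - (D + \<sigma>))"
      unfolding powr_add[symmetric] by (rule arg_cong[where f = "\<lambda>e. t powr e"]) simp
    ultimately show ?thesis
      by simp
  qed
  have "((\<lambda>t. (4 * pi) powr (- D) * (t powr (- 1 - (D + \<sigma>)) * exp (- a / t))) has_integral
      (4 * pi) powr (- D) * (a powr (- (D + \<sigma>)) * Gamma (D + \<sigma>))) {0<..}"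
    by (intro has_integral_mult_right has_integral_Gamma_inverse a D)
  then have I: "((\<lambda>t. gauss_kernel t x * t powr (- 1 - \<sigma>)) has_integral
      (4 * pi) powr (- D) * (a powr (- (D + \<sigma>)) * Gamma (D + \<sigma>))) {0<..}"
    by (rule has_integral_eq[rotated]) (simp add: eq)
  have m: "(\<lambda>t. gauss_kernel t x * t powr (- 1 - \<sigma>)) \<in> borel_measurable borel"
    unfolding gauss_kernel_def by measurable
  show "set_integrable lborel {0<..} (\<lambda>t. gauss_kernel t x * t powr (- 1 - \<sigma>))"
    by (rule set_lebesgue_integral_of_has_integral(1)[OF I _ m]) (auto simp: gauss_kernel_nonneg)
  have "(LINT t:{0<..}|lborel. gauss_kernel t x * t powr (- 1 - \<sigma>))
      = (4 * pi) powr (- D) * (a powr (- (D + \<sigma>)) * Gamma (D + \<sigma>))"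
    by (rule set_lebesgue_integral_of_has_integral(2)[OF I _ m]) (auto simp: gauss_kernel_nonneg)
  also have "a powr (- (D + \<sigma>)) = 4 powr (D + \<sigma>) * r powr (- 2 * D - 2 * \<sigma>)"
  proof -
    have "(r\<^sup>2) powr (- (D + \<sigma>)) = r powr (2 * (- (D + \<sigma>)))"
      using r by (simp add: powr_powr flip: powr_numeral)
    also have "2 * (- (D + \<sigma>)) = - 2 * D - 2 * \<sigma>"
      by simp
    finally have "(r\<^sup>2) powr (- (D + \<sigma>)) = r powr (- 2 * D - 2 * \<sigma>)" .
    moreover have "a powr (- (D + \<sigma>)) = (r\<^sup>2) powr (- (D + \<sigma>)) / 4 powr (- (D + \<sigma>))"
      unfolding a_def by (rule powr_divide)
    ultimately show ?thesis
      by (simp only: powr_minus_divide[of 4]) simp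
  qed
  also have "(4 * pi) powr (- D) * (4 powr (D + \<sigma>) * r powr (- 2 * D - 2 * \<sigma>) * Gamma (D + \<sigma>))
      = 4 powr \<sigma> * Gamma (D + \<sigma>) / pi powr D * r powr (- 2 * D - 2 * \<sigma>)"
    by (simp add: powr_mult powr_minus powr_add field_simps)
  finally show "(LINT t:{0<..}|lborel. gauss_kernel t x * t powr (- 1 - \<sigma>))
       = 4 powr \<sigma> * Gamma (real CARD('d) / 2 + \<sigma>) / pi powr (real CARD('d) / 2)
           * znorm x powr (- real CARD('d) - 2 * \<sigma>)"
    by (simp add: D_def r_def)
qed

text \<open>The two antiderivatives carry the denominators 2 - \<sigma> and D + \<sigma> + 1. Both
  exceed 1 on the given range, so the factor 2 counts the two pieces and does not depend on
  \<sigma>.\<close>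

lemma cutoff_integral:
  fixes r D \<sigma> :: real
  assumes r: "r > 0" and \<sigma>: "- D < \<sigma>" "\<sigma> < 1"
  defines "f \<equiv> \<lambda>t. (if t \<le> r\<^sup>2 then t\<^sup>2 * r powr (- 2 * D - 6) else t powr (- D - 1)) * t powr (- 1 - \<sigma>)"
  shows "set_integrable lborel {0<..} f" "(LINT t:{0<..}|lborel. f t) \<le> 2 * r powr (- 2 * D - 2 * \<sigma> - 2)"
proof -
  define I where "I = r powr (- 2 * D - 6) * ((r\<^sup>2) powr (1 - \<sigma> + 1) / (1 - \<sigma> + 1))"
  define J where "J = - ((r\<^sup>2) powr (- D - 2 - \<sigma> + 1)) / (- D - 2 - \<sigma> + 1)"
  have r2: "(r\<^sup>2) powr e = r powr (2 * e)" for e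
    using r by (simp add: powr_powr flip: powr_numeral)
  have "((\<lambda>t. r powr (- 2 * D - 6) * t powr (1 - \<sigma>)) has_integral I) {0..r\<^sup>2}"
    unfolding I_def using \<sigma> by (intro has_integral_mult_right has_integral_powr_from_0) auto
  then have 1: "(f has_integral I) {0..r\<^sup>2}"
  proof (rule has_integral_spike[rotated 2])
    show "negligible {0 :: real}" by simp
    fix t assume "t \<in> {0..r\<^sup>2} - {0}"
    then have t: "t > 0" "t \<le> r\<^sup>2" by auto
    then have "t\<^sup>2 * t powr (- 1 - \<sigma>) = t powr (2 + (- 1 - \<sigma>))"
      by (simp only: powr_add powr_numeral)
    then show "f t = r powr (- 2 * D - 6) * t powr (1 - \<sigma>)"
      using t by (simp add: f_def mult_ac)
  qed
  have "((\<lambda>t. t powr (- D - 2 - \<sigma>)) has_integral J) {r\<^sup>2..}"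
    unfolding J_def using \<sigma> r by (intro has_integral_powr_to_inf) auto
  then have 2: "(f has_integral J) {r\<^sup>2..}"
  proof (rule has_integral_spike[rotated 2])
    show "negligible {r\<^sup>2}" by simp
    fix t assume "t \<in> {r\<^sup>2..} - {r\<^sup>2}"
    then have "f t = t powr (- D - 1) * t powr (- 1 - \<sigma>)"
      by (simp add: f_def)
    also have "\<dots> = t powr (- D - 2 - \<sigma>)"
      unfolding powr_add[symmetric] by (rule arg_cong[where f = "\<lambda>e. t powr e"]) simp
    finally show "f t = t powr (- D - 2 - \<sigma>)" .
  qed
  have "{0..r\<^sup>2} \<inter> {r\<^sup>2..} = {r\<^sup>2}" "{0..r\<^sup>2} \<union> {r\<^sup>2..} = {0..}"
    using r by (auto intro: order_trans[OF zero_le_power2])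
  then have "(f has_integral (I + J)) {0..}"
    using has_integral_Un[OF 1 2] by simp
  then have IJ: "(f has_integral (I + J)) {0<..}"
    by (simp add: has_integral_greaterThan_iff_atLeast)
  have m: "f \<in> borel_measurable borel"
    unfolding f_def by measurable
  show "set_integrable lborel {0<..} f"
    by (rule set_lebesgue_integral_of_has_integral(1)[OF IJ _ m]) (auto simp: f_def)
  have "I \<le> r powr (- 2 * D - 2 * \<sigma> - 2)"
  proof -
    have "I \<le> r powr (- 2 * D - 6) * ((r\<^sup>2) powr (1 - \<sigma> + 1) / 1)"
      unfolding I_def using \<sigma> by (intro mult_left_mono divide_left_mono) auto
    also have "\<dots> = r powr (- 2 * D - 6 + 2 * (1 - \<sigma> + 1))"
      by (simp only: r2 div_by_1 powr_add[of r "- 2 * D - 6"])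
    also have "- 2 * D - 6 + 2 * (1 - \<sigma> + 1) = - 2 * D - 2 * \<sigma> - 2"
      by simp
    finally show ?thesis .
  qed
  moreover have "J \<le> r powr (- 2 * D - 2 * \<sigma> - 2)"
  proof -
    have "J = (r\<^sup>2) powr (- D - 2 - \<sigma> + 1) / (D + \<sigma> + 1)"
    proof -
      have "- D - 2 - \<sigma> + 1 = - (D + \<sigma> + 1)"
        by simp
      then show ?thesis
        by (simp only: J_def minus_divide_divide)
    qed
    also have "\<dots> \<le> (r\<^sup>2) powr (- D - 2 - \<sigma> + 1) / 1"
      using \<sigma> by (intro divide_left_mono) auto
    also have "\<dots> = r powr (2 * (- D - 2 - \<sigma> + 1))"
      by (simp only: r2 div_by_1)
    also have "2 * (- D - 2 - \<sigma> + 1) = - 2 * D - 2 * \<sigma> - 2"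
      by simp
    finally show ?thesis .
  qed
  moreover have "(LINT t:{0<..}|lborel. f t) = I + J"
    by (rule set_lebesgue_integral_of_has_integral(2)[OF IJ _ m]) (auto simp: f_def)
  ultimately show "(LINT t:{0<..}|lborel. f t) \<le> 2 * r powr (- 2 * D - 2 * \<sigma> - 2)"
    by linarith
qed

section \<open>Convergence of the Riesz integral and the asymptotics\<close>

lemma borel_measurable_heat_kernel [measurable]: "(\<lambda>t. heat_kernel t x) \<in> borel_measurable borel"
proof (rule borel_measurable_continuous_onI)
  have "continuous_on UNIV (\<lambda>s. line_heat 0 s k)" for k
    using line_heat_ode[of 0 k] by (intro continuous_at_imp_continuous_on ballI DERIV_isCont)
  then show "continuous_on UNIV (\<lambda>t. heat_kernel t x)"
    unfolding heat_kernel_eq_prod[of _ x "\<lambda>_. 0"] by (intro continuous_on_prod) auto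
qed

text \<open>Near 0 the kernel is O(t^\<delta>), with \<delta> = 1 away from the origin and \<delta>
  = 0 at it, and the weight asks for \<sigma> < \<delta>. At infinity it is O(t^(- d / 2)), and the
  weight asks for \<sigma> > - d / 2.\<close>

lemma heat_kernel_riesz_integrable:
  fixes x :: "int ^ 'd"
  assumes \<sigma>: "- real CARD('d) / 2 < \<sigma>" "\<sigma> < 1" and x: "\<sigma> < 0 \<or> x \<noteq> 0"
  shows "set_integrable lborel {0<..} (\<lambda>t. heat_kernel t x * t powr (- 1 - \<sigma>))"
proof -
  let ?f = "\<lambda>t. heat_kernel t x * t powr (- 1 - \<sigma>)" and ?d = "real CARD('d)"
  have meas: "set_borel_measurable lborel A ?f" if "A \<in> sets borel" for A
    using that unfolding set_borel_measurable_def by simp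
  have l0: "lnorm x \<ge> 0"
    by (simp add: lnorm_def sum_nonneg)
  define \<delta> :: real where "\<delta> = (if x = 0 then 0 else 1)"
  have \<delta>: "\<delta> - \<sigma> > 0" "\<delta> \<le> lnorm x"
    using \<sigma> x lnorm_ge_1[of x] l0 by (auto simp: \<delta>_def)
  have "set_integrable lborel {0..1} (\<lambda>t. exp 8 ^ CARD('d) * t powr (\<delta> - 1 - \<sigma>))"
    using set_lebesgue_integral_of_has_integral(1)[OF has_integral_powr_from_0[of "\<delta> - 1 - \<sigma>" 1]] \<delta>
    by (intro set_integrable_mult_right) auto
  then have "set_integrable lborel {0<..1} (\<lambda>t. exp 8 ^ CARD('d) * t powr (\<delta> - 1 - \<sigma>))"
    by (rule set_integrable_subset) auto
  then have 1: "set_integrable lborel {0<..1} ?f"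
  proof (rule set_integrable_bound[OF _ meas AE_I2[OF impI]])
    fix t :: real
    assume "t \<in> {0<..1}"
    then have t: "0 < t" "t \<le> 1" by auto
    have "exp (- lnorm x) * t powr lnorm x \<le> 1 * t powr \<delta>"
      using t \<delta> l0 by (intro mult_mono powr_mono') auto
    then have "\<bar>heat_kernel t x\<bar> \<le> exp 8 ^ CARD('d) * t powr \<delta>"
      by (intro order_trans[OF heat_kernel_small_time[OF t]] mult_left_mono) auto
    then have "\<bar>heat_kernel t x\<bar> * t powr (- 1 - \<sigma>) \<le> exp 8 ^ CARD('d) * t powr \<delta> * t powr (- 1 - \<sigma>)"
      by (intro mult_right_mono) auto
    also have "\<dots> = exp 8 ^ CARD('d) * t powr (\<delta> - 1 - \<sigma>)"
      by (simp add: mult.assoc flip: powr_add) (simp add: algebra_simps)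
    finally show "norm (?f t) \<le> norm (exp 8 ^ CARD('d) * t powr (\<delta> - 1 - \<sigma>))"
      by (simp add: abs_mult)
  qed auto
  obtain C where C: "C > 0"
    "\<And>t (x :: int ^ 'd). t \<ge> 1 \<Longrightarrow>
       \<bar>heat_kernel t x - gauss_kernel t x\<bar> \<le> C * exp (- lnorm x / sqrt t) * t powr (- ?d / 2 - 1)"
    by (rule heat_kernel_minus_gauss_large_time) blast
  have "set_integrable lborel {1..} (\<lambda>t. (C + 1) * t powr (- ?d / 2 - 1 - \<sigma>))"
    using set_lebesgue_integral_of_has_integral(1)[OF has_integral_powr_to_inf[of "- ?d / 2 - 1 - \<sigma>" 1]] \<sigma>
    by (intro set_integrable_mult_right) auto
  then have 2: "set_integrable lborel {1..} ?f"
  proof (rule set_integrable_bound[OF _ meas AE_I2[OF impI]])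
    fix t :: real
    assume "t \<in> {1..}"
    then have t: "1 \<le> t" by auto
    have "C * exp (- lnorm x / sqrt t) * t powr (- ?d / 2 - 1) \<le> C * 1 * t powr (- ?d / 2)"
      using t C(1) l0 by (intro mult_mono powr_mono) auto
    moreover have "gauss_kernel t x \<le> 1 * t powr (- ?d / 2)"
      using t by (intro order_trans[OF gauss_kernel_le] mult_right_mono) auto
    ultimately have "\<bar>heat_kernel t x\<bar> \<le> C * t powr (- ?d / 2) + t powr (- ?d / 2)"
      using C(2)[OF t, of x] gauss_kernel_nonneg[of t x] by linarith
    then have "\<bar>heat_kernel t x\<bar> * t powr (- 1 - \<sigma>) \<le> ((C + 1) * t powr (- ?d / 2)) * t powr (- 1 - \<sigma>)"
      by (intro mult_right_mono) (auto simp: algebra_simps)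
    also have "\<dots> = (C + 1) * t powr (- ?d / 2 - 1 - \<sigma>)"
      unfolding mult.assoc powr_add[symmetric] by (rule arg_cong[where f = "\<lambda>e. (C + 1) * t powr e"]) simp
    finally show "norm (?f t) \<le> norm ((C + 1) * t powr (- ?d / 2 - 1 - \<sigma>))"
      using C(1) by (simp add: abs_mult)
  qed auto
  have "{0<..} = {0<..1} \<union> {1::real..}"
    by auto
  then show ?thesis
    using set_integrable_Un[OF 1 2] by simp
qed

text \<open>The reciprocal Gamma function is entire, hence bounded on the compact interval [-1, b]
  that contains every -\<sigma>, the poles of Gamma included.\<close>

lemma bounded_inverse_Gamma:
  fixes b :: real
  obtains G where "G \<ge> 0" "\<And>\<sigma>. - b < \<sigma> \<Longrightarrow> \<sigma> < 1 \<Longrightarrow> 1 / \<bar>Gamma (- \<sigma>)\<bar> \<le> G"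
proof -
  have "compact (rGamma ` {- 1..b})"
    by (intro compact_continuous_image continuous_intros) auto
  then obtain G where G: "\<forall>y\<in>{- 1..b}. \<bar>rGamma y\<bar> \<le> G"
    by (auto simp: bounded_iff dest!: compact_imp_bounded)
  have "1 / \<bar>Gamma (- \<sigma>)\<bar> \<le> max 0 G" if "- b < \<sigma>" "\<sigma> < 1" for \<sigma>
    using bspec[OF G, of "- \<sigma>"] that by (simp add: rGamma_inverse_Gamma divide_inverse)
  then show ?thesis
    using that[of "max 0 G"] by auto
qed

text \<open>Finiteness is expressed by integrability, since the integral in \<open>riesz\<close>
  would silently be 0 for a non-integrable function. Uniformity lies in the order of quantifiers:
  both \<open>C\<close> and \<open>R\<close> precede \<sigma>.\<close>

theorem theoremA1:
  fixes d :: real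
  defines "d \<equiv> real CARD('d::finite)"
  shows "(\<forall>\<sigma>. - d / 2 < \<sigma> \<and> \<sigma> < 1 \<and> \<sigma> \<noteq> 0 \<longrightarrow>
            (\<forall>x :: int ^ 'd. \<not> (0 < \<sigma> \<and> x = 0) \<longrightarrow>
               set_integrable lborel {0<..} (\<lambda>t. heat_kernel t x * t powr (- 1 - \<sigma>))))
       \<and> (\<exists>C R. \<forall>\<sigma>. - d / 2 < \<sigma> \<and> \<sigma> < 1 \<and> \<sigma> \<noteq> 0 \<longrightarrow>
            (\<forall>x :: int ^ 'd. znorm x \<ge> R \<longrightarrow>
               \<bar>riesz \<sigma> x - (4 powr \<sigma> * Gamma (d / 2 + \<sigma>) / (pi powr (d / 2) * \<bar>Gamma (- \<sigma>)\<bar>))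
                  * znorm x powr (- d - 2 * \<sigma>)\<bar>
               \<le> C * znorm x powr (- d - 2 * \<sigma> - 2)))"
proof (intro conjI allI impI; (elim conjE)?)
  fix \<sigma> :: real and x :: "int ^ 'd"
  assume "- d / 2 < \<sigma>" "\<sigma> < 1" "\<sigma> \<noteq> 0" "\<not> (0 < \<sigma> \<and> x = 0)"
  then show "set_integrable lborel {0<..} (\<lambda>t. heat_kernel t x * t powr (- 1 - \<sigma>))"
    by (intro heat_kernel_riesz_integrable) (auto simp: d_def)
next
  obtain C where C: "C > 0"
    "\<And>t (x :: int ^ 'd). t > 0 \<Longrightarrow> znorm x \<ge> 2 \<Longrightarrow>
       \<bar>heat_kernel t x - gauss_kernel t x\<bar>
         \<le> C * (if t \<le> (znorm x)\<^sup>2 then t\<^sup>2 * znorm x powr (- d - 6) else t powr (- d / 2 - 1))"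
    unfolding d_def by (rule heat_kernel_minus_gauss_bound) blast
  obtain G where G: "G \<ge> 0" "\<And>\<sigma>. - (d / 2) < \<sigma> \<Longrightarrow> \<sigma> < 1 \<Longrightarrow> 1 / \<bar>Gamma (- \<sigma>)\<bar> \<le> G"
    using bounded_inverse_Gamma[of "d / 2"] by blast
  \<comment> \<open>In the constant, G bounds the Gamma prefactor, C the kernel difference and 2 the
    cut-off integral. The radius 2 is the threshold of the kernel estimate.\<close>
  have "\<bar>riesz \<sigma> x - (4 powr \<sigma> * Gamma (d / 2 + \<sigma>) / (pi powr (d / 2) * \<bar>Gamma (- \<sigma>)\<bar>))
              * znorm x powr (- d - 2 * \<sigma>)\<bar> \<le> G * (C * 2) * znorm x powr (- d - 2 * \<sigma> - 2)"
    if \<sigma>: "- d / 2 < \<sigma>" "\<sigma> < 1" and x: "znorm x \<ge> 2" for \<sigma> and x :: "int ^ 'd"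
  proof -
    let ?p = "\<lambda>t. heat_kernel t x * t powr (- 1 - \<sigma>)" and ?g = "\<lambda>t. gauss_kernel t x * t powr (- 1 - \<sigma>)"
    let ?b = "\<lambda>t. (if t \<le> (znorm x)\<^sup>2 then t\<^sup>2 * znorm x powr (- 2 * (d / 2) - 6) else t powr (- (d / 2) - 1)) * t powr (- 1 - \<sigma>)"
    have x0: "x \<noteq> 0"
      using x by (auto simp: znorm_def)
    have p: "set_integrable lborel {0<..} ?p"
      using \<sigma> x0 by (intro heat_kernel_riesz_integrable) (auto simp: d_def)
    have g: "set_integrable lborel {0<..} ?g"
      "(LINT t:{0<..}|lborel. ?g t) = 4 powr \<sigma> * Gamma (d / 2 + \<sigma>) / pi powr (d / 2) * znorm x powr (- d - 2 * \<sigma>)"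
      using gauss_kernel_riesz_integral[of x \<sigma>] \<sigma> x by (auto simp: d_def)
    have b: "set_integrable lborel {0<..} ?b"
      "(LINT t:{0<..}|lborel. ?b t) \<le> 2 * znorm x powr (- 2 * (d / 2) - 2 * \<sigma> - 2)"
      using cutoff_integral[of "znorm x" "d / 2" \<sigma>] \<sigma> x by auto
    have e: "- 2 * (d / 2) - 6 = - d - 6" "- (d / 2) - 1 = - d / 2 - 1"
      by simp_all
    have le: "norm (?p t - ?g t) \<le> C * ?b t" if "t \<in> {0<..}" for t
    proof -
      have "norm (?p t - ?g t) = \<bar>heat_kernel t x - gauss_kernel t x\<bar> * t powr (- 1 - \<sigma>)"
        by (simp add: abs_mult flip: left_diff_distrib)
      also have "\<dots> \<le> (C * (if t \<le> (znorm x)\<^sup>2 then t\<^sup>2 * znorm x powr (- d - 6) else t powr (- d / 2 - 1))) * t powr (- 1 - \<sigma>)"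
        using that x by (intro mult_right_mono C(2)) auto
      finally show ?thesis
        unfolding e by (simp only: mult.assoc)
    qed
    have "\<bar>(LINT t:{0<..}|lborel. ?p t) - (LINT t:{0<..}|lborel. ?g t)\<bar> = norm (LINT t:{0<..}|lborel. ?p t - ?g t)"
      using p g by (simp add: set_integral_diff)
    also have "\<dots> \<le> (LINT t:{0<..}|lborel. norm (?p t - ?g t))"
      using p g by (intro set_integral_norm_bound set_integral_diff)
    also have "\<dots> \<le> (LINT t:{0<..}|lborel. C * ?b t)"
      using p g b le by (intro set_integral_mono set_integrable_norm set_integral_diff set_integrable_mult_right)
    also have "\<dots> = C * (LINT t:{0<..}|lborel. ?b t)"
      by simp
    also have "\<dots> \<le> C * (2 * znorm x powr (- 2 * (d / 2) - 2 * \<sigma> - 2))"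
      using C(1) b(2) by (intro mult_left_mono) auto
    finally have diff: "\<bar>(LINT t:{0<..}|lborel. ?p t) - (LINT t:{0<..}|lborel. ?g t)\<bar> \<le> C * 2 * znorm x powr (- d - 2 * \<sigma> - 2)"
      by simp
    \<comment> \<open>The Gaussian integral equals the main term exactly, so only the integral of
      the difference remains.\<close>
    have "riesz \<sigma> x - (4 powr \<sigma> * Gamma (d / 2 + \<sigma>) / (pi powr (d / 2) * \<bar>Gamma (- \<sigma>)\<bar>)) * znorm x powr (- d - 2 * \<sigma>)
        = 1 / \<bar>Gamma (- \<sigma>)\<bar> * ((LINT t:{0<..}|lborel. ?p t) - (LINT t:{0<..}|lborel. ?g t))"
      using x0 unfolding riesz_def g(2) by (simp add: right_diff_distrib mult_ac)
    then have "\<bar>riesz \<sigma> x - (4 powr \<sigma> * Gamma (d / 2 + \<sigma>) / (pi powr (d / 2) * \<bar>Gamma (- \<sigma>)\<bar>)) * znorm x powr (- d - 2 * \<sigma>)\<bar>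
        = 1 / \<bar>Gamma (- \<sigma>)\<bar> * \<bar>(LINT t:{0<..}|lborel. ?p t) - (LINT t:{0<..}|lborel. ?g t)\<bar>"
      by (simp add: abs_mult)
    also have "\<dots> \<le> G * (C * 2 * znorm x powr (- d - 2 * \<sigma> - 2))"
      using diff G(2)[of \<sigma>] G(1) \<sigma> by (intro mult_mono) auto
    finally show ?thesis
      by (simp only: mult.assoc)
  qed
  then show "\<exists>C R. \<forall>\<sigma>. - d / 2 < \<sigma> \<and> \<sigma> < 1 \<and> \<sigma> \<noteq> 0 \<longrightarrow>
            (\<forall>x :: int ^ 'd. znorm x \<ge> R \<longrightarrow>
               \<bar>riesz \<sigma> x - (4 powr \<sigma> * Gamma (d / 2 + \<sigma>) / (pi powr (d / 2) * \<bar>Gamma (- \<sigma>)\<bar>))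
                  * znorm x powr (- d - 2 * \<sigma>)\<bar>
               \<le> C * znorm x powr (- d - 2 * \<sigma> - 2))"
    by (intro exI[of _ "G * (C * 2)"] exI[of _ 2]) blast
qed

end
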